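(* Let $K$ be a field of characteristic zero, let $n\ge 1$, and let $[1,n]=I_1\sqcup\ldots\sqcup I_\ell$ be a partition into consecutive segments, with associated parabolic subgroup $P\subset \mathrm{GL}(n)$ and unipotent radical $U$ of $P$. Let $\mathcal F=K(\mathrm{GL}(n))$ and let $\mathcal F^U$ be the field of invariants for the action of $U$ on $\mathrm{GL}(n)$ by conjugation. Then the system of polynomials $\{\mathcal J_{ij}:\ (i,j)\in\mathbb S\}$ freely generates $\mathcal F^U$ over $K$; that is, the $\mathcal J_{ij}$, $(i,j)\in\mathbb S$, lie in $\mathcal F^U$, are algebraically independent over $K$, and generate $\mathcal F^U$ as a field extension of $K$.
   Context: Write $[a,b]$ for the integer segment $\{a,a+1,\ldots,b\}$. The partition $[1,n]=I_1\sqcup\ldots\sqcup I_\ell$ into consecutive segments ($I_1$ first, $I_\ell$ last) defines the parabolic subgroup $P$ of block upper triangular matrices in $\mathrm{GL}(n)$, with unipotent radical $U=\{E+A\}$, where $E$ is the identity matrix and $A$ runs over the span of the matrix units $E_{ij}$ with $i\in I_k$, $j\in I_m$, $k<m$. The group $U$ acts on functions on $\mathrm{GL}(n)$ by $(\rho(g)f)(x)=f(g^{-1}xg)$. For $i\in[1,n]$ put $i'=n+1-i$, and for $T\subseteq[1,n]$ put $T'=\{i': i\in T\}$. Let $\mathbb S$ be the set of pairs $(i,j)\in[1,n]^2$ such that $i\in I_k$, $j\in I_m'$ with $k\ge m$. Decompose $\mathbb S=\mathbb S_0\sqcup\mathbb S_1$, where $\mathbb S_0$ consists of the pairs with $i+j\le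 n+1$ (on or above the anti-diagonal) and $\mathbb S_1$ of the pairs with $i+j>n+1$ (strictly below the anti-diagonal). Let $x_{ij}$ be the standard coordinate functions on $n\times n$ matrices, $\mathbb X=(x_{ij})_{i,j=1}^n$, and let $\mathbb X^*=(x^*_{ij})$ be the adjugate matrix, so $\mathbb X\mathbb X^*=\mathbb X^*\mathbb X=\det(\mathbb X)E$. For $(i,j)\in\mathbb S_0$, $\mathcal J_{ij}$ is the minor of $\mathbb X$ with columns $[1,j]$ and rows $\{i\}\cup[j'+1,n]$. For $(i,j)\in\mathbb S_1$, $\mathcal J_{ij}$ is the determinant of the $j\times j$ matrix whose first $i'$ rows form the submatrix of $\mathbb X$ with columns $[1,j]$ and the last $i'$ rows of $\mathbb X$, and whose remaining $j-i'$ rows form the submatrix of $\mathbb X^*$ with columns $[1,j]$ and the last $j-i'$ rows of $\mathbb X^*$ (rows in each submatrix kept in increasing order). *)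

theory Defs
  imports
    "HOL-Library.Poly_Mapping"
    "HOL-Library.Product_Lexorder"
    "HOL-Computational_Algebra.Fraction_Field"
    "HOL-Computational_Algebra.Polynomial_Factorial"
    "Jordan_Normal_Form.Determinant"
    "Jordan_Normal_Form.Gauss_Jordan_Elimination"
    "Jordan_Normal_Form.DL_Submatrix"
begin

section \<open>Polynomials and rational functions in several variables\<close>

type_synonym ('v, 'k) mpoly = "('v \<Rightarrow>\<^sub>0 nat) \<Rightarrow>\<^sub>0 'k"

definition mp_var :: "'v \<Rightarrow> ('v, 'k::field) mpoly" where
  "mp_var v = Poly_Mapping.single (Poly_Mapping.single v 1) 1"

definition mp_const :: "'k::field \<Rightarrow> ('v, 'k) mpoly" where
  "mp_const c = Poly_Mapping.single 0 c"

definition mp_vars :: "('v, 'k::field) mpoly \<Rightarrow> 'v set" where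
  "mp_vars p = (\<Union>m\<in>Poly_Mapping.keys p. Poly_Mapping.keys m)"

definition mp_eval :: "('k \<Rightarrow> 'a) \<Rightarrow> ('v \<Rightarrow> 'a) \<Rightarrow> ('v, 'k::field) mpoly \<Rightarrow> 'a::comm_ring_1" where
  "mp_eval \<phi> a p = (\<Sum>m\<in>Poly_Mapping.keys p. \<phi> (Poly_Mapping.lookup p m) * (\<Prod>v\<in>Poly_Mapping.keys m. a v ^ Poly_Mapping.lookup m v))"

text \<open>The fraction field of the polynomial ring in variables indexed by all pairs of natural
  numbers; only the variables with both indices in \<open>{1..n}\<close> occur in \<open>GL_field n\<close> below.\<close>

type_synonym 'k ratfun = "(nat \<times> nat, 'k) mpoly fract"

definition rf_const :: "'k::field \<Rightarrow> 'k ratfun" where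
  "rf_const c = to_fract (mp_const c)"

text \<open>The value of a rational function at a point; it is computed from any representation
  whose denominator does not vanish there (see \<open>rf_eval_Fract\<close>).\<close>

definition rf_eval :: "('k \<Rightarrow> 'a) \<Rightarrow> (nat \<times> nat \<Rightarrow> 'a) \<Rightarrow> 'k::field ratfun \<Rightarrow> 'a::field" where
  "rf_eval \<phi> a f = (THE y. \<exists>p q. f = Fract p q \<and> mp_eval \<phi> a q \<noteq> 0 \<and>
                             y = mp_eval \<phi> a p / mp_eval \<phi> a q)"

definition is_subfield :: "'a::field set \<Rightarrow> bool" where
  "is_subfield L \<longleftrightarrow> 0 \<in> L \<and> 1 \<in> L \<and>
     (\<forall>x\<in>L. \<forall>y\<in>L. x + y \<in> L \<and> x * y \<in> L) \<and> (\<forall>x\<in>L. - x \<in> L \<and> inverse x \<in> L)"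

definition field_adjoin :: "'k::field ratfun set \<Rightarrow> 'k ratfun set" where
  "field_adjoin A = is_subfield hull (range rf_const \<union> A)"

definition alg_independent :: "'v set \<Rightarrow> ('v \<Rightarrow> 'k::field ratfun) \<Rightarrow> bool" where
  "alg_independent V f \<longleftrightarrow>
     (\<forall>p :: ('v, 'k) mpoly. mp_vars p \<subseteq> V \<longrightarrow> mp_eval rf_const f p = 0 \<longrightarrow> p = 0)"


section \<open>The function field of the general linear group\<close>

text \<open>Matrices in \<^typ>\<open>'a mat\<close> are indexed from 0. All indices below are 1-based, and
  \<open>entry\<close> and \<open>submat\<close> do the conversion.\<close>

definition entry :: "'a mat \<Rightarrow> nat \<Rightarrow> nat \<Rightarrow> 'a" where
  "entry A i j = A $$ (i - 1, j - 1)"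

definition submat :: "'a mat \<Rightarrow> nat set \<Rightarrow> nat set \<Rightarrow> 'a mat" where
  "submat A R C = submatrix A {r. Suc r \<in> R} {c. Suc c \<in> C}"

definition generic_mat :: "nat \<Rightarrow> (nat \<times> nat, 'k::field) mpoly mat" where
  "generic_mat n = mat n n (\<lambda>(i, j). mp_var (i + 1, j + 1))"

definition GL_regular :: "nat \<Rightarrow> 'k::field ratfun set" where
  "GL_regular n = {to_fract p / to_fract (det (generic_mat n)) ^ r | p r.
                     mp_vars p \<subseteq> {1..n} \<times> {1..n}}"

definition GL_field :: "nat \<Rightarrow> 'k::field ratfun set" where
  "GL_field n = {a / b | a b. a \<in> GL_regular n \<and> b \<in> GL_regular n \<and> b \<noteq> 0}"

text \<open>The matrix \<open>inverse g * X * g\<close> over the function field, as a point.\<close>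

definition conj_point :: "nat \<Rightarrow> 'k::field mat \<Rightarrow> nat \<times> nat \<Rightarrow> 'k ratfun" where
  "conj_point n g = (\<lambda>(i, j). entry
     (map_mat rf_const (the (mat_inverse g)) * map_mat to_fract (generic_mat n)
        * map_mat rf_const g) i j)"

definition conj_act :: "nat \<Rightarrow> 'k::field mat \<Rightarrow> 'k ratfun \<Rightarrow> 'k ratfun" where
  "conj_act n g f = rf_eval rf_const (conj_point n g) f"


section \<open>The unipotent radical and its field of invariants\<close>

definition segment_partition :: "nat \<Rightarrow> nat \<Rightarrow> (nat \<Rightarrow> nat set) \<Rightarrow> bool" where
  "segment_partition n l I \<longleftrightarrow>
     (\<Union>k\<in>{1..l}. I k) = {1..n} \<and>
     (\<forall>k\<in>{1..l}. \<exists>a b. a \<le> b \<and> I k = {a..b}) \<and>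
     (\<forall>k\<in>{1..l}. \<forall>m\<in>{1..l}. k < m \<longrightarrow> (\<forall>i\<in>I k. \<forall>j\<in>I m. i < j))"

definition unipotent_radical :: "nat \<Rightarrow> nat \<Rightarrow> (nat \<Rightarrow> nat set) \<Rightarrow> 'k::field mat set" where
  "unipotent_radical n l I = {1\<^sub>m n + A | A. A \<in> carrier_mat n n \<and>
     (\<forall>i\<in>{1..n}. \<forall>j\<in>{1..n}. entry A i j \<noteq> 0 \<longrightarrow>
        (\<exists>k\<in>{1..l}. \<exists>m\<in>{1..l}. k < m \<and> i \<in> I k \<and> j \<in> I m))}"

definition invariant_field :: "nat \<Rightarrow> nat \<Rightarrow> (nat \<Rightarrow> nat set) \<Rightarrow> 'k::field ratfun set" where
  "invariant_field n l I =
     {f \<in> GL_field n. \<forall>g \<in> unipotent_radical n l I. conj_act n g f = f}"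


section \<open>The generators\<close>

definition opp :: "nat \<Rightarrow> nat \<Rightarrow> nat" where
  "opp n i = n + 1 - i"

definition index_set :: "nat \<Rightarrow> nat \<Rightarrow> (nat \<Rightarrow> nat set) \<Rightarrow> (nat \<times> nat) set" where
  "index_set n l I = {(i, j) \<in> {1..n} \<times> {1..n}.
     \<exists>k\<in>{1..l}. \<exists>m\<in>{1..l}. i \<in> I k \<and> j \<in> opp n ` I m \<and> k \<ge> m}"

text \<open>The two cases are the pairs on or above, respectively strictly below, the anti-diagonal.
  The last \<open>r\<close> rows of a matrix of size \<open>n\<close> have indices \<open>{n + 1 - r..n}\<close>.\<close>

definition J :: "nat \<Rightarrow> nat \<times> nat \<Rightarrow> (nat \<times> nat, 'k::field) mpoly" where
  "J n = (\<lambda>(i, j).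
     if i + j \<le> n + 1
     then det (submat (generic_mat n) ({i} \<union> {opp n j + 1..n}) {1..j})
     else det (submat (generic_mat n) {n + 1 - opp n i..n} {1..j} @\<^sub>r
               submat (adj_mat (generic_mat n)) {n + 1 - (j - opp n i)..n} {1..j}))"


section \<open>Evaluation is a ring homomorphism, and conjugation acts on rational functions\<close>

lemma mp_eval_superset:
  assumes "finite M" "Poly_Mapping.keys p \<subseteq> M" "\<phi> 0 = 0"
  shows "mp_eval \<phi> a p = (\<Sum>m\<in>M. \<phi> (Poly_Mapping.lookup p m) * (\<Prod>v\<in>Poly_Mapping.keys m. a v ^ Poly_Mapping.lookup m v))"
  unfolding mp_eval_def
  by (rule sum.mono_neutral_left) (use assms in \<open>auto simp: in_keys_iff\<close>)

lemma monom_eval_superset: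
  fixes a :: "'v \<Rightarrow> 'a::comm_ring_1"
  assumes "finite V" "Poly_Mapping.keys m \<subseteq> V"
  shows "(\<Prod>v\<in>Poly_Mapping.keys m. a v ^ Poly_Mapping.lookup m v) = (\<Prod>v\<in>V. a v ^ Poly_Mapping.lookup m v)"
  by (rule prod.mono_neutral_left) (use assms in \<open>auto simp: in_keys_iff\<close>)

lemma monom_eval_add:
  fixes a :: "'v \<Rightarrow> 'a::comm_ring_1"
  shows "(\<Prod>v\<in>Poly_Mapping.keys (m + m'). a v ^ Poly_Mapping.lookup (m + m') v) =
         (\<Prod>v\<in>Poly_Mapping.keys m. a v ^ Poly_Mapping.lookup m v) * (\<Prod>v\<in>Poly_Mapping.keys m'. a v ^ Poly_Mapping.lookup m' v)"
proof -
  let ?V = "Poly_Mapping.keys m \<union> Poly_Mapping.keys m'"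
  have k: "Poly_Mapping.keys (m + m') \<subseteq> ?V" by (rule Poly_Mapping.keys_add)
  show ?thesis
    using monom_eval_superset[of ?V "m + m'" a] monom_eval_superset[of ?V m a]
      monom_eval_superset[of ?V m' a] k
    by (simp add: lookup_add power_add prod.distrib)
qed

lemma poly_mapping_expand: "p = (\<Sum>m\<in>Poly_Mapping.keys p. Poly_Mapping.single m (Poly_Mapping.lookup p m))"
  by (rule poly_mapping_eqI) (simp add: lookup_sum lookup_single when_def in_keys_iff)

context
  fixes \<phi> :: "'k::field \<Rightarrow> 'a::comm_ring_1"
  assumes \<phi>: "comm_ring_hom \<phi>"
begin

interpretation phi: comm_ring_hom \<phi> by (rule \<phi>)

lemma mp_eval_single:
  "mp_eval \<phi> a (Poly_Mapping.single m c) = \<phi> c * (\<Prod>v\<in>Poly_Mapping.keys m. a v ^ Poly_Mapping.lookup m v)"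
  by (simp add: mp_eval_def)

lemma mp_eval_0: "mp_eval \<phi> a 0 = 0"
  by (simp add: mp_eval_def)

lemma mp_eval_1: "mp_eval \<phi> a 1 = 1"
  using mp_eval_single[of a 0 1] by simp

lemma mp_eval_add: "mp_eval \<phi> a (p + q) = mp_eval \<phi> a p + mp_eval \<phi> a q"
proof -
  let ?M = "Poly_Mapping.keys p \<union> Poly_Mapping.keys q"
  have "Poly_Mapping.keys (p + q) \<subseteq> ?M" by (rule Poly_Mapping.keys_add)
  then show ?thesis
    using mp_eval_superset[of ?M "p + q" \<phi> a] mp_eval_superset[of ?M p \<phi> a]
      mp_eval_superset[of ?M q \<phi> a]
    by (simp add: lookup_add phi.hom_add distrib_right sum.distrib)
qed

lemma mp_eval_sum: "mp_eval \<phi> a (\<Sum>x\<in>A. f x) = (\<Sum>x\<in>A. mp_eval \<phi> a (f x))"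
  by (induction A rule: infinite_finite_induct) (simp_all add: mp_eval_0 mp_eval_add)

lemma mp_eval_mult: "mp_eval \<phi> a (p * q) = mp_eval \<phi> a p * mp_eval \<phi> a q"
proof -
  have "p * q = (\<Sum>m\<in>Poly_Mapping.keys p. \<Sum>m'\<in>Poly_Mapping.keys q.
      Poly_Mapping.single (m + m') (Poly_Mapping.lookup p m * Poly_Mapping.lookup q m'))"
    by (subst poly_mapping_expand[of p], subst poly_mapping_expand[of q])
      (simp add: sum_product mult_single)
  then show ?thesis
    by (simp add: mp_eval_sum mp_eval_single monom_eval_add phi.hom_mult mp_eval_def[of \<phi> a p]
        mp_eval_def[of \<phi> a q] sum_product mult_ac)
qed

lemma comm_ring_hom_mp_eval: "comm_ring_hom (mp_eval \<phi> a)"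
  by unfold_locales (simp_all add: mp_eval_0 mp_eval_1 mp_eval_add mp_eval_mult)

lemma mp_eval_const: "mp_eval \<phi> a (mp_const c) = \<phi> c"
  by (simp add: mp_const_def mp_eval_single)

lemma mp_eval_var: "mp_eval \<phi> a (mp_var v) = a v"
  by (simp add: mp_var_def mp_eval_single)

end

lemma mp_eval_cong:
  assumes "\<And>v. v \<in> mp_vars p \<Longrightarrow> a v = b v"
  shows "mp_eval \<phi> a p = mp_eval \<phi> b p"
proof -
  have "(\<Prod>v\<in>Poly_Mapping.keys m. a v ^ Poly_Mapping.lookup m v) =
        (\<Prod>v\<in>Poly_Mapping.keys m. b v ^ Poly_Mapping.lookup m v)"
    if "m \<in> Poly_Mapping.keys p" for m
    by (rule prod.cong) (use that assms in \<open>auto simp: mp_vars_def intro!: arg_cong2[where f = "(^)"]\<close>)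
  then show ?thesis by (simp add: mp_eval_def)
qed

lemma mp_eval_comp:
  assumes "comm_ring_hom \<psi>"
  shows "\<psi> (mp_eval \<phi> a p) = mp_eval (\<lambda>c. \<psi> (\<phi> c)) (\<lambda>v. \<psi> (a v)) p"
proof -
  interpret comm_ring_hom \<psi> by fact
  show ?thesis by (simp add: mp_eval_def hom_distribs)
qed

lemma comm_ring_hom_mp_const: "comm_ring_hom mp_const"
  by unfold_locales (simp_all add: mp_const_def single_add mult_single)

lemma comm_ring_hom_to_fract: "comm_ring_hom to_fract"
  by unfold_locales simp_all

lemma comm_ring_hom_rf_const: "comm_ring_hom rf_const"
proof -
  interpret c: comm_ring_hom "mp_const :: 'a \<Rightarrow> (nat \<times> nat, 'a) mpoly"
    by (rule comm_ring_hom_mp_const)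
  show ?thesis
    by unfold_locales (simp_all add: rf_const_def c.hom_add c.hom_mult)
qed

lemma mp_eval_id: "mp_eval mp_const mp_var p = p"
proof -
  have *: "(\<Prod>v\<in>V. mp_var v ^ Poly_Mapping.lookup m v) = Poly_Mapping.single (\<Sum>v\<in>V. Poly_Mapping.single v (Poly_Mapping.lookup m v)) 1"
    if "finite V" for V and m :: "'a \<Rightarrow>\<^sub>0 nat"
  proof -
    have pow: "mp_var v ^ e = Poly_Mapping.single (Poly_Mapping.single v e) 1" for v :: 'a and e
      by (induction e) (simp_all add: mp_var_def mult_single flip: single_add)
    show ?thesis
      using that by (induction V rule: finite_induct) (simp_all add: pow mult_single)
  qed
  have "mp_eval mp_const mp_var p = (\<Sum>m\<in>Poly_Mapping.keys p. Poly_Mapping.single m (Poly_Mapping.lookup p m))"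
    unfolding mp_eval_def
    by (intro sum.cong refl) (simp add: * mp_const_def mult_single flip: poly_mapping_expand)
  then show ?thesis by (simp flip: poly_mapping_expand)
qed

lemma rf_eval_Fract:
  assumes \<phi>: "comm_ring_hom \<phi>" and q: "mp_eval \<phi> a q \<noteq> 0"
  shows "rf_eval \<phi> a (Fract p q) = mp_eval \<phi> a p / mp_eval \<phi> a q"
  unfolding rf_eval_def
proof (rule the_equality)
  show "\<exists>p' q'. Fract p q = Fract p' q' \<and> mp_eval \<phi> a q' \<noteq> 0 \<and>
      mp_eval \<phi> a p / mp_eval \<phi> a q = mp_eval \<phi> a p' / mp_eval \<phi> a q'"
    using q by blast
next
  fix y assume "\<exists>p' q'. Fract p q = Fract p' q' \<and> mp_eval \<phi> a q' \<noteq> 0 \<and>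
      y = mp_eval \<phi> a p' / mp_eval \<phi> a q'"
  then obtain p' q' where *: "Fract p q = Fract p' q'" "mp_eval \<phi> a q' \<noteq> 0"
    and y: "y = mp_eval \<phi> a p' / mp_eval \<phi> a q'" by blast
  have "q \<noteq> 0" "q' \<noteq> 0" using q * mp_eval_0[OF \<phi>] by metis+
  with * have "p * q' = p' * q" by (simp add: eq_fract)
  then have "mp_eval \<phi> a p * mp_eval \<phi> a q' = mp_eval \<phi> a p' * mp_eval \<phi> a q"
    by (metis mp_eval_mult[OF \<phi>])
  then show "y = mp_eval \<phi> a p / mp_eval \<phi> a q"
    using q *(2) y by (simp add: frac_eq_eq mult.commute)
qed

lemma mp_vars_add: "mp_vars (p + q) \<subseteq> mp_vars p \<union> mp_vars q"
  using Poly_Mapping.keys_add[of p q] by (auto simp: mp_vars_def)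

lemma mp_vars_mult: "mp_vars (p * q) \<subseteq> mp_vars p \<union> mp_vars q"
proof
  fix v assume "v \<in> mp_vars (p * q)"
  then obtain m where m: "m \<in> Poly_Mapping.keys (p * q)" "v \<in> Poly_Mapping.keys m"
    by (auto simp: mp_vars_def)
  then obtain a b where "m = a + b" "a \<in> Poly_Mapping.keys p" "b \<in> Poly_Mapping.keys q"
    using Poly_Mapping.keys_mult[of p q] by blast
  with m(2) Poly_Mapping.keys_add[of a b] show "v \<in> mp_vars p \<union> mp_vars q"
    by (auto simp: mp_vars_def)
qed

lemma mp_vars_const [simp]: "mp_vars (mp_const c) = {}"
  by (simp add: mp_vars_def mp_const_def)

lemma mp_vars_0 [simp]: "mp_vars 0 = {}"
  by (simp add: mp_vars_def)

lemma mp_vars_1 [simp]: "mp_vars 1 = {}"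
  by (simp add: mp_vars_def)

lemma mp_vars_var [simp]: "mp_vars (mp_var v) = {v}"
  by (simp add: mp_vars_def mp_var_def)

lemma mp_vars_sum: "(\<And>x. x \<in> A \<Longrightarrow> mp_vars (f x) \<subseteq> V) \<Longrightarrow> mp_vars (\<Sum>x\<in>A. f x) \<subseteq> V"
proof (induction A rule: infinite_finite_induct)
  case (insert x A)
  then show ?case using mp_vars_add[of "f x" "\<Sum>x\<in>A. f x"] by fastforce
qed simp_all

lemma mp_vars_prod: "(\<And>x. x \<in> A \<Longrightarrow> mp_vars (f x) \<subseteq> V) \<Longrightarrow> mp_vars (\<Prod>x\<in>A. f x) \<subseteq> V"
proof (induction A rule: infinite_finite_induct)
  case (insert x A)
  then show ?case using mp_vars_mult[of "f x" "\<Prod>x\<in>A. f x"] by fastforce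
qed simp_all

lemma mp_vars_power: "mp_vars p \<subseteq> V \<Longrightarrow> mp_vars (p ^ r) \<subseteq> V"
proof (induction r)
  case (Suc r)
  then show ?case using mp_vars_mult[of p "p ^ r"] by fastforce
qed simp

lemma mp_vars_det_generic: "mp_vars (det (generic_mat n)) \<subseteq> {1..n} \<times> {1..n}"
proof -
  have "mp_vars (signof p * (\<Prod>i=0..<n. generic_mat n $$ (i, p i)) :: (nat \<times> nat, 'a) mpoly)
      \<subseteq> {1..n} \<times> {1..n}" if p: "p permutes {0..<n}" for p
  proof -
    have "mp_vars (\<Prod>i=0..<n. generic_mat n $$ (i, p i) :: (nat \<times> nat, 'a) mpoly)
        \<subseteq> {1..n} \<times> {1..n}"
    proof (rule mp_vars_prod)
      fix i assume "i \<in> {0..<n}"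
      moreover from this have "p i < n" using permutes_in_image[OF p, of i] by simp
      ultimately show "mp_vars (generic_mat n $$ (i, p i) :: (nat \<times> nat, 'a) mpoly)
          \<subseteq> {1..n} \<times> {1..n}"
        by (simp add: generic_mat_def)
    qed
    moreover have "mp_vars (signof p :: (nat \<times> nat, 'a) mpoly) = {}"
      by (simp add: sign_def mp_vars_def flip: single_one single_uminus)
    ultimately show ?thesis
      using mp_vars_mult[of "signof p" "\<Prod>i=0..<n. generic_mat n $$ (i, p i)"] by blast
  qed
  moreover have "generic_mat n \<in> carrier_mat n n" by (simp add: generic_mat_def)
  ultimately show ?thesis
    unfolding det_def'[OF \<open>generic_mat n \<in> carrier_mat n n\<close>]
    by (intro mp_vars_sum) simp
qed

lemma GL_field_eq:
  "GL_field n = {Fract p q | p q. mp_vars p \<subseteq> {1..n} \<times> {1..n} \<and>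
                                  mp_vars q \<subseteq> {1..n} \<times> {1..n} \<and> q \<noteq> 0}"
    (is "_ = ?R")
proof (intro subset_antisym subsetI)
  let ?D = "det (generic_mat n)" let ?V = "{1..n} \<times> {1..n}"
  fix f :: "'a ratfun" assume "f \<in> GL_field n"
  then obtain p r q s where f: "f = (to_fract p / to_fract ?D ^ r) / (to_fract q / to_fract ?D ^ s)"
    and pq: "mp_vars p \<subseteq> ?V" "mp_vars q \<subseteq> ?V" and nz: "to_fract q / to_fract ?D ^ s \<noteq> 0"
    unfolding GL_field_def GL_regular_def by blast
  interpret comm_ring_hom "to_fract :: (nat \<times> nat, 'a) mpoly \<Rightarrow> _" by (rule comm_ring_hom_to_fract)
  have "mp_vars (u * ?D ^ t) \<subseteq> ?V" if "mp_vars u \<subseteq> ?V"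
    for u :: "(nat \<times> nat, 'a) mpoly" and t
    by (rule order_trans[OF mp_vars_mult]) (use that mp_vars_power[OF mp_vars_det_generic] in simp)
  note vars = this[OF pq(1), of s] this[OF pq(2), of r]
  have eq: "f = Fract (p * ?D ^ s) (q * ?D ^ r)"
    by (simp add: f Fract_conv_to_fract hom_power)
  show "f \<in> ?R"
  proof (cases "q * ?D ^ r = 0")
    case True
    then have "f = Fract 0 1" using eq by (simp only: Fract_conv_to_fract) simp
    then show ?thesis by (intro CollectI exI[of _ 0] exI[of _ 1]) simp
  next
    case False
    then show ?thesis
      by (intro CollectI exI[of _ "p * ?D ^ s"] exI[of _ "q * ?D ^ r"]) (use eq vars in simp)
  qed
next
  let ?V = "{1..n} \<times> {1..n}"
  fix f :: "'a ratfun" assume "f \<in> ?R"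
  then obtain p q where f: "f = Fract p q" and pq: "mp_vars p \<subseteq> ?V" "mp_vars q \<subseteq> ?V" "q \<noteq> 0"
    by blast
  have reg: "to_fract p' \<in> GL_regular n" if "mp_vars p' \<subseteq> ?V" for p' :: "(nat \<times> nat, 'a) mpoly"
    unfolding GL_regular_def using that by (intro CollectI exI[of _ p'] exI[of _ 0]) simp
  show "f \<in> GL_field n"
    unfolding GL_field_def f Fract_conv_to_fract
    by (intro CollectI exI[of _ "to_fract p"] exI[of _ "to_fract q"])
      (use pq reg in simp)
qed

lemma mat_inverse_props:
  assumes g: "(g :: 'k::field mat) \<in> carrier_mat n n" and "invertible_mat g"
  defines "h \<equiv> the (mat_inverse g)"
  shows "h \<in> carrier_mat n n" "g * h = 1\<^sub>m n" "h * g = 1\<^sub>m n"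
proof -
  obtain B where B: "g * B = 1\<^sub>m n" "B * g = 1\<^sub>m (dim_row B)"
    using assms by (auto simp: invertible_mat_def inverts_mat_def)
  have "B \<in> carrier_mat n n"
    using B g by (metis carrier_matD(2) carrier_matI index_mult_mat(2,3) index_one_mat(2,3))
  then have "g \<in> Units (ring_mat TYPE('k) n ())"
    using B g by (auto simp: Units_def ring_mat_def)
  then obtain C where "mat_inverse g = Some C"
    using mat_inverse(1)[OF g, where b = "()"] by (cases "mat_inverse g") auto
  then show "h \<in> carrier_mat n n" "g * h = 1\<^sub>m n" "h * g = 1\<^sub>m n"
    using mat_inverse(2)[OF g] by (auto simp: h_def)
qed

lemma map_mat_map_mat: "map_mat f (map_mat g A) = map_mat (\<lambda>x. f (g x)) A"
  by (rule eq_matI) auto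

text \<open>On \<open>GL_field n\<close>, conjugation is substitution in numerator and denominator; the latter
  stays nonzero.\<close>

lemma conj_act_Fract:
  fixes g :: "'k::field mat" and p q :: "(nat \<times> nat, 'k) mpoly"
  assumes g: "g \<in> carrier_mat n n" "invertible_mat g"
    and q: "mp_vars q \<subseteq> {1..n} \<times> {1..n}" "q \<noteq> 0"
  shows "mp_eval rf_const (conj_point n g) q \<noteq> 0"
    and "conj_act n g (Fract p q) =
           mp_eval rf_const (conj_point n g) p / mp_eval rf_const (conj_point n g) q"
proof -
  define h where "h = the (mat_inverse g)"
  note h = mat_inverse_props[OF g, folded h_def]
  let ?c = "mp_const :: 'k \<Rightarrow> (nat \<times> nat, 'k) mpoly"
  let ?X = "generic_mat n :: (nat \<times> nat, 'k) mpoly mat"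
  interpret c: comm_ring_hom ?c by (rule comm_ring_hom_mp_const)
  interpret t: comm_ring_hom "to_fract :: (nat \<times> nat, 'k) mpoly \<Rightarrow> _" by (rule comm_ring_hom_to_fract)
  define G H where "G = map_mat ?c g" and "H = map_mat ?c h"
  have X: "?X \<in> carrier_mat n n" by (simp add: generic_mat_def)
  have GH: "G \<in> carrier_mat n n" "H \<in> carrier_mat n n" "G * H = 1\<^sub>m n" "H * G = 1\<^sub>m n"
    using g h c.mat_hom_mult[OF g(1) h(1)] c.mat_hom_mult[OF h(1) g(1)] c.mat_hom_one[of n]
    by (auto simp: G_def H_def)
  define b where "b = (\<lambda>(i, j). entry (H * ?X * G) i j)"
  define b' where "b' = (\<lambda>(i, j). entry (G * ?X * H) i j)"
  have pt: "conj_point n g v = to_fract (b v)" if v: "v \<in> {1..n} \<times> {1..n}" for v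
  proof -
    have "map_mat to_fract (H * ?X * G) =
        map_mat rf_const h * map_mat to_fract ?X * map_mat rf_const g"
      using t.mat_hom_mult[of "H * ?X" n n G n] t.mat_hom_mult[of H n n ?X n] GH X
      by (simp add: G_def H_def map_mat_map_mat rf_const_def[abs_def])
    moreover have "entry (map_mat to_fract (H * ?X * G)) (fst v) (snd v) = to_fract (b v)"
      using v GH(1,2) X by (cases v) (auto simp: entry_def b_def simp del: assoc_mult_mat)
    ultimately show ?thesis by (cases v) (simp add: conj_point_def h_def)
  qed
  define Q where "Q = mp_eval mp_const b q"
  have Q: "mp_eval rf_const (conj_point n g) q = to_fract Q"
  proof -
    have "mp_eval rf_const (conj_point n g) q = mp_eval rf_const (\<lambda>v. to_fract (b v)) q"
      by (rule mp_eval_cong) (use pt q in blast)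
    then show ?thesis
      by (simp add: Q_def mp_eval_comp[OF comm_ring_hom_to_fract] rf_const_def[abs_def])
  qed
  let ?e = "mp_eval ?c b'"
  interpret e: comm_ring_hom ?e by (rule comm_ring_hom_mp_eval[OF comm_ring_hom_mp_const])
  have ec: "?e (mp_const c) = mp_const c" for c by (rule mp_eval_const[OF comm_ring_hom_mp_const])
  have eb: "?e (b v) = mp_var v" if v: "v \<in> {1..n} \<times> {1..n}" for v
  proof -
    have eX: "map_mat ?e ?X = G * ?X * H"
      by (rule eq_matI)
        (use GH in \<open>auto simp: generic_mat_def mp_eval_var[OF comm_ring_hom_mp_const] b'_def entry_def\<close>)
    have "map_mat ?e (H * ?X * G) = H * (G * ?X * H) * G"
      using e.mat_hom_mult[of "H * ?X" n n G n] e.mat_hom_mult[of H n n ?X n] GH X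
      by (simp add: eX) (simp add: G_def H_def map_mat_map_mat ec)
    also have "\<dots> = (H * G) * ?X * (H * G)"
      using GH(1,2) X by (simp add: assoc_mult_mat[of _ n n _ n _ n])
    also have "\<dots> = ?X" using GH X by simp
    finally have "map_mat ?e (H * ?X * G) = ?X" .
    moreover have "entry (map_mat ?e (H * ?X * G)) (fst v) (snd v) = ?e (b v)"
      using v GH(1,2) X by (cases v) (auto simp: entry_def b_def simp del: assoc_mult_mat)
    ultimately have "?e (b v) = entry ?X (fst v) (snd v)" by simp
    then show ?thesis using v by (cases v) (auto simp: entry_def generic_mat_def)
  qed
  have "?e Q = mp_eval ?c (\<lambda>v. ?e (b v)) q"
    unfolding Q_def by (subst mp_eval_comp[OF e.comm_ring_hom_axioms]) (simp add: ec)
  also have "\<dots> = mp_eval ?c mp_var q"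
    by (rule mp_eval_cong) (use eb q in blast)
  finally have "?e Q = q" by (simp add: mp_eval_id)
  then have "Q \<noteq> 0" using q(2) e.hom_zero by metis
  then show nz: "mp_eval rf_const (conj_point n g) q \<noteq> 0" by (simp add: Q)
  show "conj_act n g (Fract p q) =
      mp_eval rf_const (conj_point n g) p / mp_eval rf_const (conj_point n g) q"
    unfolding conj_act_def by (rule rf_eval_Fract[OF comm_ring_hom_rf_const nz])
qed

lemma unipotent_radical_invertible:
  assumes I: "segment_partition n l I" and "g \<in> unipotent_radical n l I"
  shows "g \<in> carrier_mat n n" "invertible_mat g"
proof -
  obtain A where A: "g = 1\<^sub>m n + A" "A \<in> carrier_mat n n"
    and nz: "\<And>i j. i \<in> {1..n} \<Longrightarrow> j \<in> {1..n} \<Longrightarrow> entry A i j \<noteq> 0 \<Longrightarrow>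
      \<exists>k\<in>{1..l}. \<exists>m\<in>{1..l}. k < m \<and> i \<in> I k \<and> j \<in> I m"
    using assms(2) unfolding unipotent_radical_def by blast
  show g: "g \<in> carrier_mat n n" using A by simp
  have A0: "A $$ (i, j) = 0" if "j \<le> i" "i < n" for i j
  proof (rule ccontr)
    assume "A $$ (i, j) \<noteq> 0"
    then have "\<exists>k\<in>{1..l}. \<exists>m\<in>{1..l}. k < m \<and> Suc i \<in> I k \<and> Suc j \<in> I m"
      using nz[of "Suc i" "Suc j"] that by (simp add: entry_def)
    then have "Suc i < Suc j" using I unfolding segment_partition_def by blast
    then show False using that by simp
  qed
  have "upper_triangular g"
    using A A0 by (auto simp: upper_triangular_def)
  then have "det g = prod_list (diag_mat g)" by (rule det_upper_triangular[OF _ g])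
  also have "diag_mat g = map (\<lambda>i. 1) [0..<n]"
    using A A0 by (auto simp: diag_mat_def)
  finally have "det g = 1" by (simp add: map_replicate_const)
  then have "g \<in> Units (ring_mat TYPE('a) n ())" using det_non_zero_imp_unit[OF g] by simp
  then show "invertible_mat g"
    using g by (auto simp: Units_def ring_mat_def invertible_mat_def inverts_mat_def)
qed

end

theory Submission
  imports Defs
begin

text \<open>Write \<open>N\<close> for the group of upper unitriangular matrices and \<open>F\<close> for the function field.
  Gaussian elimination over \<open>F\<close> conjugates the generic matrix \<open>X\<close> by some \<open>a\<close> in \<open>N(F)\<close>
  to a matrix \<open>Y\<close> that vanishes strictly above the anti-diagonal: \<open>X = a Y a\<inverse>\<close>. The generators with
  \<open>i + j \<ge> n + 1\<close> are \<open>N\<close>-invariant, so they take the same values at \<open>X\<close> and \<open>Y\<close>, and at \<open>Y\<close> they form a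
  triangular system: the anti-diagonal ones determine the anti-diagonal of \<open>Y\<close>, and the one of index
  \<open>(i, j)\<close> below it is linear in \<open>Y\<^sub>i\<^sub>j\<close> with coefficients built from the anti-diagonal and the entries to the
  lower left of \<open>(i, j)\<close>.
  The remaining generators are \<open>a\<^sub>i\<^sub>k\<close> times an anti-diagonal one, with \<open>i < k\<close> in the same segment.
  Splitting \<open>a = u b\<close> with \<open>u\<close> in \<open>U(F)\<close> and \<open>b\<close> block diagonal, \<open>X\<close> is conjugate under \<open>U(F)\<close> to
  \<open>b Y b\<inverse>\<close>, whose entries are rational functions of the generators. Since \<open>U(K)\<close> is Zariski dense
  in \<open>U(F)\<close>, an invariant has the same value at both points, which gives generation. Read
  backwards, the triangular system shows that over \<open>K\<close> the generators attain every tuple of nonzero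
  values, which gives algebraic independence.\<close>

section \<open>Determinants of matrices given by functions\<close>

definition fdet :: "nat \<Rightarrow> (nat \<Rightarrow> nat \<Rightarrow> 'a::comm_ring_1) \<Rightarrow> 'a" where
  "fdet j f = det (mat j j (\<lambda>(a, b). f a b))"

lemma fdet_cong: "(\<And>a b. a < j \<Longrightarrow> b < j \<Longrightarrow> f a b = g a b) \<Longrightarrow> fdet j f = fdet j g"
  unfolding fdet_def by (rule arg_cong[where f = det]) auto

lemma fdet_0 [simp]: "fdet 0 f = 1"
  by (simp add: fdet_def)

lemma fdet_mat: "A \<in> carrier_mat n n \<Longrightarrow> fdet n (\<lambda>a b. A $$ (a, b)) = det A"
  unfolding fdet_def by (rule arg_cong[where f = det]) auto

text \<open>Cauchy-Binet with a single surviving term: the summation indices outside the image of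
  \<open>\<sigma>\<close> contribute nothing. The later rules for minors of products rest on
  this.\<close>

lemma fdet_mult:
  fixes \<sigma> :: "nat \<Rightarrow> nat"
  assumes \<sigma>: "inj_on \<sigma> {..<j}" "\<sigma> ` {..<j} \<subseteq> {..<n}"
    and 0: "\<And>a b k. a < j \<Longrightarrow> b < j \<Longrightarrow> k < n \<Longrightarrow> k \<notin> \<sigma> ` {..<j} \<Longrightarrow> A a k * B k b = 0"
  shows "fdet j (\<lambda>a b. \<Sum>k<n. A a k * B k b) = fdet j (\<lambda>a p. A a (\<sigma> p)) * fdet j (\<lambda>p b. B (\<sigma> p) b)"
proof -
  let ?A = "mat j j (\<lambda>(a, p). A a (\<sigma> p))" and ?B = "mat j j (\<lambda>(p, b). B (\<sigma> p) b)"
  have "(\<Sum>k<n. A a k * B k b) = (\<Sum>p<j. A a (\<sigma> p) * B (\<sigma> p) b)" if "a < j" "b < j" for a b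
  proof -
    have "(\<Sum>k<n. A a k * B k b) = (\<Sum>k\<in>\<sigma> ` {..<j}. A a k * B k b)"
      by (rule sum.mono_neutral_right) (use \<sigma>(2) 0[OF that] in auto)
    then show ?thesis by (simp add: sum.reindex[OF \<sigma>(1)])
  qed
  then have "mat j j (\<lambda>(a, b). \<Sum>k<n. A a k * B k b) = ?A * ?B"
    by (intro eq_matI) (auto simp: scalar_prod_def lessThan_atLeast0)
  then show ?thesis
    by (simp add: fdet_def det_mult[of _ j])
qed

lemma fdet_upper:
  assumes "\<And>a b. b < a \<Longrightarrow> a < j \<Longrightarrow> f a b = 0"
  shows "fdet j f = (\<Prod>a<j. f a a)"
proof -
  have "fdet j f = prod_list (diag_mat (mat j j (\<lambda>(a, b). f a b)))"
    unfolding fdet_def by (rule det_upper_triangular) (use assms in \<open>auto simp: upper_triangular_def\<close>)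
  also have "diag_mat (mat j j (\<lambda>(a, b). f a b)) = map (\<lambda>a. f a a) [0..<j]"
    by (auto simp: diag_mat_def)
  also have "prod_list \<dots> = (\<Prod>a<j. f a a)"
    by (simp add: prod.list_conv_set_nth lessThan_atLeast0)
  finally show ?thesis .
qed

lemma fdet_transpose: "fdet j (\<lambda>a b. f b a) = fdet j f"
proof -
  have "mat j j (\<lambda>(a, b). f b a) = transpose_mat (mat j j (\<lambda>(a, b). f a b))" by auto
  then show ?thesis by (simp add: fdet_def det_transpose[of _ j])
qed

lemma fdet_lower:
  assumes "\<And>a b. a < b \<Longrightarrow> b < j \<Longrightarrow> f a b = 0"
  shows "fdet j f = (\<Prod>a<j. f a a)"
  using fdet_upper[of j "\<lambda>a b. f b a"] assms fdet_transpose[of j f] by simp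

text \<open>The sign of the order-reversing permutation. Being a sign, it is its own inverse,
  nonzero, and in every subfield, so no closed form appears.\<close>

definition rev_sign :: "nat \<Rightarrow> 'a::comm_ring_1" where
  "rev_sign j = signof (\<lambda>a. if a < j then j - 1 - a else a)"

lemma rev_sign_square: "rev_sign j * rev_sign j = 1"
  by (simp add: rev_sign_def sign_def)

lemma rev_sign_nonzero [simp]: "rev_sign j \<noteq> (0 :: 'a::field)"
  by (simp add: rev_sign_def sign_def)

lemma fdet_rev_rows: "fdet j (\<lambda>a b. f (j - 1 - a) b) = rev_sign j * fdet j f"
proof -
  let ?p = "\<lambda>a. if a < j then j - 1 - a else a"
  have p: "?p permutes {0..<j}"
    by (rule bij_imp_permutes, rule bij_betwI[where g = ?p]) auto
  have "fdet j (\<lambda>a b. f (j - 1 - a) b) = det (mat j j (\<lambda>(a, b). mat j j (\<lambda>(a, b). f a b) $$ (?p a, b)))"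
    unfolding fdet_def by (rule arg_cong[where f = det]) auto
  also have "\<dots> = rev_sign j * fdet j f"
    unfolding fdet_def rev_sign_def by (rule det_permute_rows[OF _ p]) simp
  finally show ?thesis .
qed

lemma fdet_anti_lower:
  assumes "\<And>a b. a + b < j - 1 \<Longrightarrow> f a b = 0"
  shows "fdet j f = rev_sign j * (\<Prod>a<j. f (j - 1 - a) a)"
proof -
  have "rev_sign j * fdet j f = (\<Prod>a<j. f (j - 1 - a) a)"
    unfolding fdet_rev_rows[symmetric] by (rule fdet_upper) (use assms in auto)
  then have "rev_sign j * rev_sign j * fdet j f = rev_sign j * (\<Prod>a<j. f (j - 1 - a) a)"
    by (simp add: mult.assoc)
  then show ?thesis by (simp add: rev_sign_square)
qed

lemma fdet_anti_upper:
  assumes "\<And>a b. a < j \<Longrightarrow> b < j \<Longrightarrow> a + b > j - 1 \<Longrightarrow> f a b = 0"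
  shows "fdet j f = rev_sign j * (\<Prod>a<j. f (j - 1 - a) a)"
proof -
  have "rev_sign j * fdet j f = (\<Prod>a<j. f (j - 1 - a) a)"
    unfolding fdet_rev_rows[symmetric] by (rule fdet_lower) (use assms in auto)
  then have "rev_sign j * rev_sign j * fdet j f = rev_sign j * (\<Prod>a<j. f (j - 1 - a) a)"
    by (simp add: mult.assoc)
  then show ?thesis by (simp add: rev_sign_square)
qed

text \<open>Moving the last \<open>r\<close> rows to the top costs \<open>(- 1) ^ (m * r)\<close>
  and leaves a block lower triangular matrix.\<close>

lemma fdet_block_lower_right_zero:
  fixes f :: "nat \<Rightarrow> nat \<Rightarrow> 'a::idom"
  assumes "\<And>a b. m \<le> a \<Longrightarrow> a < m + r \<Longrightarrow> r \<le> b \<Longrightarrow> b < m + r \<Longrightarrow> f a b = 0"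
  shows "fdet (m + r) f = (- 1) ^ (m * r) * fdet r (\<lambda>a b. f (m + a) b) * fdet m (\<lambda>a b. f a (r + b))"
proof -
  let ?M = "mat (r + m) (r + m) (\<lambda>(a, b). f a b)"
  have "fdet (m + r) f = (- 1) ^ (m * r) *
      det (mat (r + m) (r + m) (\<lambda>(i, j). ?M $$ (if i < r then i + m else if i < m + r then i - r else i, j)))"
    unfolding fdet_def add.commute[of m r] by (rule det_swap_initial_rows[where k = m and n = r, unfolded add.commute[of m r]]) simp_all
  also have "mat (r + m) (r + m) (\<lambda>(i, j). ?M $$ (if i < r then i + m else if i < m + r then i - r else i, j)) =
      four_block_mat (mat r r (\<lambda>(a, b). f (m + a) b)) (0\<^sub>m r m) (mat m r (\<lambda>(a, b). f a b)) (mat m m (\<lambda>(a, b). f a (r + b)))"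
    using assms by (intro eq_matI) (auto simp: add.commute)
  also have "det \<dots> = fdet r (\<lambda>a b. f (m + a) b) * fdet m (\<lambda>a b. f a (r + b))"
    unfolding fdet_def by (rule det_four_block_mat_upper_right_zero) auto
  finally show ?thesis by (simp add: mult.assoc)
qed

text \<open>The Laplace expansion along the first row without its last term; it does not depend on the top right
  entry.\<close>

definition fdet_rest :: "nat \<Rightarrow> (nat \<Rightarrow> nat \<Rightarrow> 'a::comm_ring_1) \<Rightarrow> 'a" where
  "fdet_rest m f = (\<Sum>b<m. f 0 b * cofactor (mat (Suc m) (Suc m) (\<lambda>(a, b). f a b)) 0 b)"

lemma fdet_corner:
  "fdet (Suc m) f = (- 1) ^ m * f 0 m * fdet m (\<lambda>a b. f (Suc a) b) + fdet_rest m f"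
proof -
  let ?M = "mat (Suc m) (Suc m) (\<lambda>(a, b). f a b)"
  have "mat_delete ?M 0 m = mat m m (\<lambda>(a, b). f (Suc a) b)"
    by (rule eq_matI) (auto simp: mat_delete_def)
  then show ?thesis
    using laplace_expansion_row[of ?M "Suc m" 0]
    by (simp add: fdet_def fdet_rest_def cofactor_def)
qed

lemma fdet_rest_cong:
  assumes "\<And>a b. a \<le> m \<Longrightarrow> b \<le> m \<Longrightarrow> (a, b) \<noteq> (0, m) \<Longrightarrow> f a b = g a b"
  shows "fdet_rest m f = fdet_rest m g"
proof -
  let ?M = "\<lambda>f. mat (Suc m) (Suc m) (\<lambda>(a, b). f a b)"
  have "mat_delete (?M f) 0 b = mat_delete (?M g) 0 b" if "b < m" for b
    by (rule eq_matI) (use assms that in \<open>auto simp: mat_delete_def\<close>)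
  then show ?thesis
    unfolding fdet_rest_def cofactor_def using assms by (intro sum.cong) auto
qed

section \<open>Unitriangular matrices and the invariance of the generators\<close>

text \<open>\<open>R\<close> lists the off-diagonal positions that may be nonzero. One definition
  thus covers \<open>N\<close> with \<open>R = (<)\<close>, the group \<open>U\<close>, where
  \<open>R\<close> compares segments, and the block diagonal elements of \<open>N\<close>.\<close>

definition uni :: "(nat \<Rightarrow> nat \<Rightarrow> bool) \<Rightarrow> nat \<Rightarrow> 'a::comm_ring_1 mat \<Rightarrow> bool" where
  "uni R n g \<longleftrightarrow> g \<in> carrier_mat n n \<and> (\<forall>i<n. g $$ (i, i) = 1) \<and>
     (\<forall>i<n. \<forall>j<n. i \<noteq> j \<longrightarrow> \<not> R i j \<longrightarrow> g $$ (i, j) = 0)"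

lemma uniD:
  assumes "uni R n g"
  shows "g \<in> carrier_mat n n" "i < n \<Longrightarrow> g $$ (i, i) = 1"
    "i < n \<Longrightarrow> j < n \<Longrightarrow> i \<noteq> j \<Longrightarrow> \<not> R i j \<Longrightarrow> g $$ (i, j) = 0"
  using assms by (auto simp: uni_def)

lemma uni_mono:
  assumes "uni R n g" "\<And>i j. i < n \<Longrightarrow> j < n \<Longrightarrow> R i j \<Longrightarrow> S i j"
  shows "uni S n g"
proof -
  have "g $$ (i, j) = 0" if "i < n" "j < n" "i \<noteq> j" "\<not> S i j" for i j
    using uniD(3)[OF assms(1), of i j] assms(2)[of i j] that by auto
  then show ?thesis using uniD(1,2)[OF assms(1)] by (simp add: uni_def)
qed

lemma index_mult_sum:
  "A \<in> carrier_mat n m \<Longrightarrow> B \<in> carrier_mat m k \<Longrightarrow> p < n \<Longrightarrow> b < k \<Longrightarrow>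
    (A * B) $$ (p, b) = (\<Sum>q<m. A $$ (p, q) * B $$ (q, b))"
  by (simp add: scalar_prod_def lessThan_atLeast0)

lemma uni_det: "uni (<) n g \<Longrightarrow> det g = 1"
  using fdet_upper[of n "\<lambda>a b. g $$ (a, b)"] fdet_mat[of g n]
  by (force simp: uni_def)

lemma one_smult_mat: "(1 :: 'a::comm_ring_1) \<cdot>\<^sub>m A = A"
  by (rule eq_matI) auto

text \<open>With determinant 1 the adjugate is the inverse. It serves as the inverse of
  unitriangular matrices from here on, being polynomial in the entries and compatible with ring
  homomorphisms.\<close>

lemma uni_adj:
  assumes "uni (<) n g"
  shows "adj_mat g \<in> carrier_mat n n" "g * adj_mat g = 1\<^sub>m n" "adj_mat g * g = 1\<^sub>m n"
  using adj_mat[of g n] uni_det[OF assms] uniD(1)[OF assms]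
  by (simp_all add: one_smult_mat)

text \<open>The columns of \<open>h\<close> are found from left to right: if \<open>R i j\<close>
  fails, transitivity and the earlier columns leave only \<open>h $$ (i, j) * g $$ (j, j)\<close> in
  entry \<open>(i, j)\<close> of \<open>h * g\<close>.\<close>

lemma uni_inverse:
  fixes g h :: "'a::comm_ring_1 mat"
  assumes R: "\<And>i j. i < n \<Longrightarrow> j < n \<Longrightarrow> R i j \<Longrightarrow> i < j"
    "\<And>i j k. i < n \<Longrightarrow> j < n \<Longrightarrow> k < n \<Longrightarrow> R i j \<Longrightarrow> R j k \<Longrightarrow> R i k"
    and g: "uni R n g" and h: "h \<in> carrier_mat n n" "h * g = 1\<^sub>m n"
  shows "uni R n h"
proof -
  have *: "h $$ (i, j) = (if i = j then 1 else 0)" if "i < n" "j < n" "\<not> R i j" for i j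
    using that
  proof (induction j rule: less_induct)
    case (less j)
    have "(h * g) $$ (i, j) = (\<Sum>k<n. h $$ (i, k) * g $$ (k, j))"
      by (rule index_mult_sum) (use h(1) uniD(1)[OF g] less.prems in auto)
    also have "\<dots> = (\<Sum>k\<in>{j}. h $$ (i, k) * g $$ (k, j))"
    proof (intro sum.mono_neutral_right ballI)
      fix k assume k: "k \<in> {..<n} - {j}"
      show "h $$ (i, k) * g $$ (k, j) = 0"
      proof (cases "R k j")
        case True
        then have "k < j" "\<not> R i k" "k \<noteq> i"
          using R(1)[of k j] R(2)[of i k j] k less.prems by auto
        then show ?thesis using less.IH[of k] k less.prems by simp
      next
        case False
        then show ?thesis using uniD(3)[OF g, of k j] k less.prems by simp
      qed
    qed (use less.prems in auto)
    finally show ?case using h(2) uniD(2)[OF g] less.prems by simp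
  qed
  have "\<not> R i i" if "i < n" for i using R(1)[of i i] that by auto
  with * show ?thesis
    unfolding uni_def by (simp add: h(1))
qed

lemma uni_mult:
  fixes g h :: "'a::comm_ring_1 mat"
  assumes R: "\<And>i j. i < n \<Longrightarrow> j < n \<Longrightarrow> R i j \<Longrightarrow> i < j"
    "\<And>i j k. i < n \<Longrightarrow> j < n \<Longrightarrow> k < n \<Longrightarrow> R i j \<Longrightarrow> R j k \<Longrightarrow> R i k"
    and g: "uni R n g" and h: "uni R n h"
  shows "uni R n (g * h)"
proof -
  note car = uniD(1)[OF g] uniD(1)[OF h]
  have *: "(g * h) $$ (i, j) = (if i = j then 1 else 0)" if ij: "i < n" "j < n" "\<not> R i j" for i j
  proof -
    have "(g * h) $$ (i, j) = (\<Sum>k<n. g $$ (i, k) * h $$ (k, j))"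
      by (rule index_mult_sum) (use car ij in auto)
    also have "\<dots> = (\<Sum>k\<in>{i}. g $$ (i, k) * h $$ (k, j))"
    proof (intro sum.mono_neutral_right ballI)
      fix k assume k: "k \<in> {..<n} - {i}"
      have "\<not> R i k \<or> k \<noteq> j \<and> \<not> R k j" using R(2)[of i k j] ij k by auto
      then show "g $$ (i, k) * h $$ (k, j) = 0"
        using uniD(3)[OF g, of i k] uniD(3)[OF h, of k j] ij k by auto
    qed (use ij in auto)
    finally show ?thesis using uniD(2)[OF g] uniD(2,3)[OF h] ij by auto
  qed
  have "\<not> R i i" if "i < n" for i using R(1)[of i i] that by auto
  with * show ?thesis
    unfolding uni_def using car by (simp del: index_mult_mat(1))
qed

text \<open>Rows and columns are counted from 0 here, while \<open>j\<close> remains the size of the minor: \<open>JM n X i j\<close> is the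
  value at \<open>X\<close> of the generator with index \<open>(i + 1, j)\<close>. In \<open>minor1\<close> the matrix \<open>Z\<close> stands for the adjugate of
  \<open>X\<close>.\<close>

definition minor0 :: "nat \<Rightarrow> 'a::comm_ring_1 mat \<Rightarrow> nat \<Rightarrow> nat \<Rightarrow> 'a" where
  "minor0 n X i j = fdet j (\<lambda>a b. X $$ (if a = 0 then i else n - j + a, b))"

definition minor1 :: "nat \<Rightarrow> 'a::comm_ring_1 mat \<Rightarrow> 'a mat \<Rightarrow> nat \<Rightarrow> nat \<Rightarrow> 'a" where
  "minor1 n X Z i j = fdet j (\<lambda>a b. if a < n - i then X $$ (i + a, b) else Z $$ (n - j + a, b))"

definition JM :: "nat \<Rightarrow> 'a::comm_ring_1 mat \<Rightarrow> nat \<Rightarrow> nat \<Rightarrow> 'a" where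
  "JM n X i j = (if i + j \<le> n then minor0 n X i j else minor1 n X (adj_mat X) i j)"

text \<open>The first \<open>j\<close> columns of the product involve only the first
  \<open>j\<close> columns of \<open>R\<close>, transformed by the leading block of
  \<open>g\<close>, of determinant 1. The rows of \<open>R\<close> are arbitrary, so they may mix
  rows of a matrix and of its adjugate.\<close>

lemma fdet_mult_uni:
  assumes g: "uni (<) n g" and j: "j \<le> n"
  shows "fdet j (\<lambda>a b. \<Sum>q<n. R a q * g $$ (q, b)) = fdet j R"
proof -
  have "fdet j (\<lambda>a b. \<Sum>q<n. R a q * g $$ (q, b)) =
      fdet j (\<lambda>a p. R a (id p)) * fdet j (\<lambda>p b. g $$ (id p, b))"
    by (rule fdet_mult) (use j uniD(3)[OF g] in auto)
  also have "fdet j (\<lambda>p b. g $$ (id p, b)) = (\<Prod>a<j. g $$ (a, a))"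
    by (simp, rule fdet_upper) (use j uniD(3)[OF g] in auto)
  also have "\<dots> = 1" by (rule prod.neutral) (use j uniD(2)[OF g] in auto)
  finally show ?thesis by simp
qed

lemma minor0_mult_uni:
  assumes g: "uni (<) n g" and X: "X \<in> carrier_mat n n" and ij: "j \<le> n" "i < n"
  shows "minor0 n (X * g) i j = minor0 n X i j"
proof -
  have "minor0 n (X * g) i j =
      fdet j (\<lambda>a b. \<Sum>q<n. X $$ (if a = 0 then i else n - j + a, q) * g $$ (q, b))"
    unfolding minor0_def
    by (rule fdet_cong, rule index_mult_sum[of _ n n _ n]) (use X uniD(1)[OF g] ij in auto)
  then show ?thesis by (simp add: fdet_mult_uni[OF g ij(1)] minor0_def)
qed

lemma minor1_mult_uni:
  assumes g: "uni (<) n g" and X: "X \<in> carrier_mat n n" "Z \<in> carrier_mat n n" and j: "j \<le> n" "i < n"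
  shows "minor1 n (X * g) (Z * g) i j = minor1 n X Z i j"
proof -
  have "minor1 n (X * g) (Z * g) i j =
      fdet j (\<lambda>a b. \<Sum>q<n. (if a < n - i then X $$ (i + a, q) else Z $$ (n - j + a, q)) * g $$ (q, b))"
    unfolding minor1_def
    by (rule fdet_cong) (use X uniD(1)[OF g] j in \<open>auto simp: index_mult_sum[of _ n n _ n] simp del: index_mult_mat(1)\<close>)
  then show ?thesis by (simp add: fdet_mult_uni[OF g j(1)] minor1_def)
qed

text \<open>Left multiplication by \<open>h\<close> adds to row \<open>i\<close> multiples of later
  rows, and \<open>h0\<close> confines these to rows of index greater than \<open>n - j\<close>,
  which are already in the minor.\<close>

lemma minor0_uni_mult:
  assumes h: "uni (<) n h" and X: "X \<in> carrier_mat n n" and ij: "j \<le> n" "i + j \<le> n" "i < n"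
    and h0: "\<And>q. i < q \<Longrightarrow> q \<le> n - j \<Longrightarrow> q < n \<Longrightarrow> h $$ (i, q) = 0"
  shows "minor0 n (h * X) i j = minor0 n X i j"
proof -
  let ?\<rho> = "\<lambda>a. if a = 0 then i else n - j + a"
  have "minor0 n (h * X) i j = fdet j (\<lambda>a b. \<Sum>k<n. h $$ (?\<rho> a, k) * X $$ (k, b))"
    unfolding minor0_def
    by (rule fdet_cong, rule index_mult_sum[of _ n n _ n]) (use X uniD(1)[OF h] ij in auto)
  also have "\<dots> = fdet j (\<lambda>a p. h $$ (?\<rho> a, ?\<rho> p)) * fdet j (\<lambda>p b. X $$ (?\<rho> p, b))"
  proof (rule fdet_mult)
    show "inj_on ?\<rho> {..<j}" using ij by (auto simp: inj_on_def)
    show "?\<rho> ` {..<j} \<subseteq> {..<n}" using ij by auto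
    fix a b k assume a: "a < j" and k: "k < n" "k \<notin> ?\<rho> ` {..<j}"
    have "k \<noteq> i" using k(2) a by (auto simp: image_iff)
    have "k \<le> n - j"
    proof (rule ccontr)
      assume "\<not> k \<le> n - j"
      then have "k = ?\<rho> (k - (n - j))" "k - (n - j) < j" using k(1) by auto
      then show False using k(2) by blast
    qed
    then have "h $$ (?\<rho> a, k) = 0"
      using h0[of k] uniD(3)[OF h, of "?\<rho> a" k] \<open>k \<noteq> i\<close> k(1) a ij by (cases "i < k") auto
    then show "h $$ (?\<rho> a, k) * X $$ (k, b) = 0" by simp
  qed
  also have "fdet j (\<lambda>a p. h $$ (?\<rho> a, ?\<rho> p)) = (\<Prod>a<j. h $$ (?\<rho> a, ?\<rho> a))"
    by (rule fdet_upper) (use uniD(3)[OF h] ij in auto)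
  also have "\<dots> = 1"
    by (rule prod.neutral) (use uniD(2)[OF h] ij in auto)
  finally show ?thesis by (simp add: minor0_def)
qed

text \<open>The rows taken from \<open>X\<close> are its last ones, and so are those taken from
  \<open>Z\<close>. An upper unitriangular \<open>h\<close> maps each family to combinations of
  itself, which gives the block diagonal transition matrix \<open>?H\<close>.\<close>

lemma minor1_uni_mult:
  assumes h: "uni (<) n h" and X: "X \<in> carrier_mat n n" "Z \<in> carrier_mat n n"
    and ij: "j \<le> n" "i < n" "n < i + j"
  shows "minor1 n (h * X) (h * Z) i j = minor1 n X Z i j"
proof -
  let ?m = "n - i"
  let ?M = "\<lambda>a b. if a < ?m then X $$ (i + a, b) else Z $$ (n - j + a, b)"
  let ?H = "\<lambda>a p. if a < ?m then (if p < ?m then h $$ (i + a, i + p) else 0)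
                   else (if p < ?m then 0 else h $$ (n - j + a, n - j + p))"
  have m: "?m \<le> j" using ij by simp
  \<comment> \<open>Rows are counted from \<open>s\<close>, and \<open>w\<close> is a number of last
    rows: a row of the product among the last \<open>w\<close> involves only the last
    \<open>w\<close> rows of \<open>W\<close>.\<close>
  have ent: "(h * W) $$ (s + a, b) = (\<Sum>p\<in>{n - s - w..<n - s}. h $$ (s + a, s + p) * W $$ (s + p, b))"
    if "W \<in> carrier_mat n n" "s + a < n" "b < n" "n - s - w \<le> a" "s \<le> n" for W s a b w
  proof -
    have "(h * W) $$ (s + a, b) = (\<Sum>k<n. h $$ (s + a, k) * W $$ (k, b))"
      by (rule index_mult_sum) (use that uniD(1)[OF h] in auto)
    also have "\<dots> = (\<Sum>k\<in>(+) s ` {n - s - w..<n - s}. h $$ (s + a, k) * W $$ (k, b))"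
    proof (intro sum.mono_neutral_right ballI)
      show "(+) s ` {n - s - w..<n - s} \<subseteq> {..<n}" using that by auto
      fix k assume k: "k \<in> {..<n} - (+) s ` {n - s - w..<n - s}"
      have "k < s + a"
      proof (rule ccontr)
        assume "\<not> k < s + a"
        then have "k = s + (k - s)" "k - s \<in> {n - s - w..<n - s}" using that k by auto
        then show False using k by blast
      qed
      then show "h $$ (s + a, k) * W $$ (k, b) = 0"
        using uniD(3)[OF h, of "s + a" k] that k by simp
    qed simp
    finally show ?thesis by (simp only: sum.reindex inj_on_add o_def)
  qed
  have "minor1 n (h * X) (h * Z) i j = fdet j (\<lambda>a b. \<Sum>p<j. ?H a p * ?M p b)"
    unfolding minor1_def
  proof (rule fdet_cong)
    fix a b assume ab: "a < j" "b < j"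
    show "(if a < ?m then (h * X) $$ (i + a, b) else (h * Z) $$ (n - j + a, b)) = (\<Sum>p<j. ?H a p * ?M p b)"
    proof (cases "a < ?m")
      case True
      have "(\<Sum>p<j. ?H a p * ?M p b) = (\<Sum>p\<in>{..<?m}. ?H a p * ?M p b)"
        by (rule sum.mono_neutral_right) (use m True in auto)
      also have "\<dots> = (\<Sum>p\<in>{0..<?m}. h $$ (i + a, i + p) * X $$ (i + p, b))"
        by (rule sum.cong) (use True in auto)
      finally show ?thesis
        using ent[of X i a b "?m"] X True ab ij by simp
    next
      case False
      have "(\<Sum>p<j. ?H a p * ?M p b) = (\<Sum>p\<in>{?m..<j}. ?H a p * ?M p b)"
        by (rule sum.mono_neutral_right) (use m False in auto)
      also have "\<dots> = (\<Sum>p\<in>{?m..<j}. h $$ (n - j + a, n - j + p) * Z $$ (n - j + p, b))"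
        by (rule sum.cong) (use False in auto)
      finally show ?thesis
        using ent[of Z "n - j" a b "j - ?m"] X False ab ij by simp
    qed
  qed
  also have "\<dots> = fdet j (\<lambda>a p. ?H a (id p)) * fdet j (\<lambda>p b. ?M (id p) b)"
    by (rule fdet_mult) auto
  also have "fdet j (\<lambda>a p. ?H a (id p)) = (\<Prod>a<j. ?H a a)"
    by (simp only: id_apply, rule fdet_upper) (use uniD(3)[OF h] ij in auto)
  also have "\<dots> = 1"
    by (rule prod.neutral) (use uniD(2)[OF h] ij in auto)
  finally show ?thesis unfolding minor1_def id_apply by simp
qed

definition anti_lower :: "nat \<Rightarrow> 'a::comm_ring_1 mat \<Rightarrow> bool" where
  "anti_lower n Y \<longleftrightarrow> Y \<in> carrier_mat n n \<and> (\<forall>i j. i + j < n - 1 \<longrightarrow> Y $$ (i, j) = 0)"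

text \<open>In the first \<open>j\<close> columns only the last \<open>j\<close> rows of
  \<open>Y\<close> can be nonzero, so the minor factors. The factor coming from \<open>a\<close> is
  triangular with diagonal \<open>a $$ (i, n - j), 1, ..., 1\<close>.\<close>

lemma minor0_uni_anti_lower:
  assumes a: "uni (<) n a" and Y: "anti_lower n Y" and ij: "0 < j" "j \<le> n" "i + j \<le> n"
  shows "minor0 n (a * Y) i j = a $$ (i, n - j) * minor0 n Y (n - j) j"
proof -
  let ?\<rho> = "\<lambda>p. if p = 0 then i else n - j + p"
  have "minor0 n (a * Y) i j = fdet j (\<lambda>p b. \<Sum>k<n. a $$ (?\<rho> p, k) * Y $$ (k, b))"
    unfolding minor0_def
    by (rule fdet_cong, rule index_mult_sum[of _ n n _ n]) (use Y uniD(1)[OF a] ij in \<open>auto simp: anti_lower_def\<close>)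
  also have "\<dots> = fdet j (\<lambda>p q. a $$ (?\<rho> p, n - j + q)) * fdet j (\<lambda>q b. Y $$ (n - j + q, b))"
  proof (rule fdet_mult)
    show "inj_on ((+) (n - j)) {..<j}" by simp
    show "(+) (n - j) ` {..<j} \<subseteq> {..<n}" using ij by auto
    fix p b k assume k: "b < j" "k < n" "k \<notin> (+) (n - j) ` {..<j}"
    have "k < n - j"
    proof (rule ccontr)
      assume "\<not> k < n - j"
      then have "k = n - j + (k - (n - j))" "k - (n - j) < j" using k by auto
      then show False using k by blast
    qed
    then show "a $$ (?\<rho> p, k) * Y $$ (k, b) = 0"
      using Y k by (simp add: anti_lower_def)
  qed
  also have "fdet j (\<lambda>q b. Y $$ (n - j + q, b)) = minor0 n Y (n - j) j"
    unfolding minor0_def by (rule fdet_cong) auto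
  also have "fdet j (\<lambda>p q. a $$ (?\<rho> p, n - j + q)) = (\<Prod>p<j. a $$ (?\<rho> p, n - j + p))"
    by (rule fdet_upper) (use uniD(3)[OF a] ij in auto)
  also have "\<dots> = (\<Prod>p\<in>{0}. a $$ (?\<rho> p, n - j + p))"
    by (rule prod.mono_neutral_right) (use uniD(2)[OF a] ij in auto)
  finally show ?thesis by simp
qed

section \<open>Conjugation of determinants, adjugates and generators\<close>

lemma det_conj:
  fixes X :: "'a::comm_ring_1 mat"
  assumes "g \<in> carrier_mat n n" "h \<in> carrier_mat n n" "X \<in> carrier_mat n n" "h * g = 1\<^sub>m n"
  shows "det (h * X * g) = det X"
proof -
  have "det h * det g = 1" using det_mult[of h n g] assms by simp
  then show ?thesis using assms by (simp add: det_mult[of _ n] mult_ac)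
qed

lemma adj_mat_unique:
  fixes X :: "'a::field mat"
  assumes X: "X \<in> carrier_mat n n" "det X \<noteq> 0" and Z: "Z \<in> carrier_mat n n" "X * Z = det X \<cdot>\<^sub>m 1\<^sub>m n"
  shows "Z = adj_mat X"
proof -
  note adj = adj_mat[OF X(1)]
  have "det X \<cdot>\<^sub>m Z = adj_mat X * X * Z"
    using adj Z(1) by (simp add: mult_smult_assoc_mat[of _ n n _ n])
  also have "\<dots> = adj_mat X * (X * Z)"
    by (rule assoc_mult_mat[OF adj(1) X(1) Z(1)])
  also have "\<dots> = det X \<cdot>\<^sub>m adj_mat X"
    unfolding Z(2) using adj by (simp add: mult_smult_distrib[of _ n n _ n])
  finally have eq: "det X \<cdot>\<^sub>m Z = det X \<cdot>\<^sub>m adj_mat X" .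
  have "Z $$ (i, j) = adj_mat X $$ (i, j)" if "i < n" "j < n" for i j
    using arg_cong[OF eq, of "\<lambda>M. M $$ (i, j)"] that X(2) Z(1) adj(1) by simp
  then show ?thesis using Z(1) adj(1) by (intro eq_matI) auto
qed

text \<open>Over a field with \<open>det X \<noteq> 0\<close> this needs no multiplicativity of the adjugate, since the adjugate is then
  determined by its product with \<open>X\<close>.\<close>

lemma adj_mat_conj:
  fixes X :: "'a::field mat"
  assumes car: "g \<in> carrier_mat n n" "h \<in> carrier_mat n n" "X \<in> carrier_mat n n"
    and inv: "h * g = 1\<^sub>m n" "g * h = 1\<^sub>m n" and X: "det X \<noteq> 0"
  shows "adj_mat (h * X * g) = h * adj_mat X * g"
proof (rule adj_mat_unique[symmetric])
  note adj = adj_mat[OF car(3)]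
  have "h * X * g * (h * adj_mat X * g) = h * (X * ((g * h) * adj_mat X)) * g"
    using car adj(1) by (simp add: assoc_mult_mat[of _ n n _ n _ n])
  also have "\<dots> = h * (det X \<cdot>\<^sub>m 1\<^sub>m n) * g"
    using car adj by (simp add: inv)
  also have "\<dots> = det X \<cdot>\<^sub>m (h * g)"
    using car by (simp add: mult_smult_distrib[of _ n n _ n] mult_smult_assoc_mat[of _ n n _ n])
  finally show "h * X * g * (h * adj_mat X * g) = det (h * X * g) \<cdot>\<^sub>m 1\<^sub>m n"
    using det_conj[OF car inv(1)] inv by simp
qed (use assms adj_mat(1)[of X n] det_conj[of g n h X] in auto)

text \<open>Below the anti-diagonal the generators are invariant under all of \<open>N\<close>. On
  or above it, \<open>h0\<close> is the condition that membership in \<open>index_set\<close>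
  guarantees for elements of \<open>U\<close>.\<close>

lemma JM_conj:
  fixes X :: "'a::field mat"
  assumes h: "uni (<) n h" and g: "uni (<) n g" and inv: "h * g = 1\<^sub>m n" "g * h = 1\<^sub>m n"
    and X: "X \<in> carrier_mat n n" "det X \<noteq> 0" and ij: "j \<le> n" "i < n"
    and h0: "\<And>q. i + j \<le> n \<Longrightarrow> i < q \<Longrightarrow> q \<le> n - j \<Longrightarrow> q < n \<Longrightarrow> h $$ (i, q) = 0"
  shows "JM n (h * X * g) i j = JM n X i j"
proof (cases "i + j \<le> n")
  case True
  have "h * X \<in> carrier_mat n n" using uniD(1)[OF h] X by simp
  then show ?thesis
    using minor0_mult_uni[OF g, of "h * X" j i] minor0_uni_mult[OF h X(1) ij(1) True ij(2) h0] True ij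
    by (simp add: JM_def)
next
  case False
  note adj = adj_mat(1)[OF X(1)]
  have "h * X \<in> carrier_mat n n" "h * adj_mat X \<in> carrier_mat n n"
    using uniD(1)[OF h] X adj by simp_all
  then show ?thesis
    using minor1_mult_uni[OF g, of "h * X" "h * adj_mat X" j i] minor1_uni_mult[OF h X(1) adj ij] False ij
      adj_mat_conj[OF uniD(1)[OF g] uniD(1)[OF h] X(1) inv X(2)]
    by (simp add: JM_def)
qed

section \<open>The generators as functions of a matrix\<close>

text \<open>\<open>pick I a\<close> is the element of \<open>I\<close> with exactly \<open>a\<close>
  smaller ones. An increasing enumeration \<open>f\<close> has this property, which makes the rows
  of \<open>submatrix\<close> explicit.\<close>

lemma pick_enum:
  fixes f :: "nat \<Rightarrow> nat"
  assumes f: "strict_mono_on {..<k} f" and I: "\<And>r. r < n \<Longrightarrow> r \<in> I \<longleftrightarrow> r \<in> f ` {..<k}" and fn: "f ` {..<k} \<subseteq> {..<n}"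
  shows "card {r. r < n \<and> r \<in> I} = k" and "a < k \<Longrightarrow> pick I a = f a"
proof -
  have inj: "inj_on f {..<k}" using f by (rule strict_mono_on_imp_inj_on)
  have "{r. r < n \<and> r \<in> I} = f ` {..<k}" using I fn by auto
  then show "card {r. r < n \<and> r \<in> I} = k" using card_image[OF inj] by simp
  assume a: "a < k"
  have fa: "f a < n" "f a \<in> I" using I fn a by auto
  have "{r \<in> I. r < f a} = f ` {..<a}"
  proof (intro subset_antisym subsetI)
    fix r assume r: "r \<in> {r \<in> I. r < f a}"
    then obtain b where b: "b < k" "r = f b" using I[of r] fa by auto
    then have "b < a" using r a strict_mono_onD[OF f, of a b] by (cases a b rule: linorder_cases) auto
    then show "r \<in> f ` {..<a}" using b by simp
  next
    fix r assume "r \<in> f ` {..<a}"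
    then obtain b where b: "b < a" "r = f b" by auto
    have "f b < f a" using strict_mono_onD[OF f, of b a] b a by simp
    then show "r \<in> {r \<in> I. r < f a}" using b fa I[of r] a by auto
  qed
  then have "card {r \<in> I. r < f a} = a"
    using card_image[OF inj_on_subset[OF inj, of "{..<a}"]] a by auto
  then show "pick I a = f a" using pick_card_in_set[OF fa(2)] by simp
qed

lemma submat_eq:
  assumes f: "strict_mono_on {..<k} f" and R: "\<And>r. r < dim_row A \<Longrightarrow> Suc r \<in> R \<longleftrightarrow> r \<in> f ` {..<k}"
    and fn: "f ` {..<k} \<subseteq> {..<dim_row A}" and j: "j \<le> dim_col A"
  shows "submat A R {1..j} = mat k j (\<lambda>(a, b). A $$ (f a, b))"
proof -
  have rows: "card {r. r < dim_row A \<and> r \<in> {r. Suc r \<in> R}} = k"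
      "\<And>a. a < k \<Longrightarrow> pick {r. Suc r \<in> R} a = f a"
    using pick_enum[OF f, of "dim_row A" "{r. Suc r \<in> R}"] R fn by auto
  have cols: "card {c. c < dim_col A \<and> c \<in> {c. Suc c \<in> {1..j}}} = j"
      "\<And>b. b < j \<Longrightarrow> pick {c. Suc c \<in> {1..j}} b = b"
    using pick_enum[of j id "dim_col A" "{c. Suc c \<in> {1..j}}"] j
    by (auto simp: strict_mono_on_def Suc_le_eq)
  show ?thesis
    unfolding submat_def submatrix_def using rows cols by (intro eq_matI) auto
qed

lemma (in comm_ring_hom) hom_fdet: "hom (fdet j f) = fdet j (\<lambda>a b. hom (f a b))"
proof -
  have "map_mat hom (mat j j (\<lambda>(a, b). f a b)) = mat j j (\<lambda>(a, b). hom (f a b))" by (rule eq_matI) auto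
  then show ?thesis unfolding fdet_def hom_det[symmetric] by simp
qed

lemma (in comm_ring_hom) hom_adj_mat:
  assumes "A \<in> carrier_mat n n"
  shows "map_mat hom (adj_mat A) = adj_mat (map_mat hom A)"
proof (rule eq_matI)
  fix i j assume ij: "i < dim_row (adj_mat (map_mat hom A))" "j < dim_col (adj_mat (map_mat hom A))"
  have "mat_delete (map_mat hom A) j i = map_mat hom (mat_delete A j i)"
    by (rule eq_matI) (use ij assms in \<open>auto simp: mat_delete_def adj_mat_def\<close>)
  then show "map_mat hom (adj_mat A) $$ (i, j) = adj_mat (map_mat hom A) $$ (i, j)"
    using ij by (simp add: adj_mat_def cofactor_def hom_mult hom_power hom_uminus)
qed (simp_all add: adj_mat_def)

lemma (in comm_ring_hom) hom_JM:
  assumes A: "A \<in> carrier_mat n n" and ij: "i < n" "j \<le> n"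
  shows "hom (JM n A i j) = JM n (map_mat hom A) i j"
proof (cases "i + j \<le> n")
  case True
  have "minor0 n (map_mat hom A) i j = hom (minor0 n A i j)"
    unfolding minor0_def hom_fdet by (rule fdet_cong) (use A ij in auto)
  then show ?thesis using True by (simp add: JM_def)
next
  case False
  have "minor1 n (map_mat hom A) (map_mat hom (adj_mat A)) i j = hom (minor1 n A (adj_mat A) i j)"
    unfolding minor1_def hom_fdet by (rule fdet_cong) (use A adj_mat(1)[OF A] ij in auto)
  then show ?thesis using False hom_adj_mat[OF A] by (simp add: JM_def)
qed

lemma generic_mat_carrier [simp]: "generic_mat n \<in> carrier_mat n n"
  by (simp add: generic_mat_def)

lemma J_eq_JM:
  assumes ij: "i < n" "1 \<le> j" "j \<le> n"
  shows "J n (Suc i, j) = (JM n (generic_mat n) i j :: (nat \<times> nat, 'k::field) mpoly)"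
proof (cases "i + j \<le> n")
  case True
  let ?X = "generic_mat n :: (nat \<times> nat, 'k) mpoly mat"
  let ?\<rho> = "\<lambda>a. if a = 0 then i else n - j + a"
  have "submat ?X ({Suc i} \<union> {opp n j + 1..n}) {1..j} = mat j j (\<lambda>(a, b). ?X $$ (?\<rho> a, b))"
  proof (rule submat_eq)
    show "strict_mono_on {..<j} ?\<rho>" using True by (auto simp: strict_mono_on_def)
    show "?\<rho> ` {..<j} \<subseteq> {..<dim_row ?X}" "j \<le> dim_col ?X" using ij by (auto simp: generic_mat_def)
    fix r assume r: "r < dim_row ?X"
    have "r \<in> ?\<rho> ` {..<j} \<longleftrightarrow> r = i \<or> n - j < r"
    proof
      assume "r = i \<or> n - j < r"
      then have "r = ?\<rho> 0 \<and> 0 < j \<or> r = ?\<rho> (r - (n - j)) \<and> r - (n - j) < j"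
        using r ij by (auto simp: generic_mat_def)
      then show "r \<in> ?\<rho> ` {..<j}" by blast
    qed auto
    then show "Suc r \<in> {Suc i} \<union> {opp n j + 1..n} \<longleftrightarrow> r \<in> ?\<rho> ` {..<j}"
      using r ij by (auto simp: opp_def generic_mat_def)
  qed
  then show ?thesis using True by (simp add: J_def JM_def minor0_def fdet_def)
next
  case False
  let ?X = "generic_mat n :: (nat \<times> nat, 'k) mpoly mat"
  have sub: "submat W {n + 1 - m..n} {1..j} = mat m j (\<lambda>(a, b). W $$ (n - m + a, b))"
    if "W \<in> carrier_mat n n" "m \<le> n" for W :: "(nat \<times> nat, 'k) mpoly mat" and m
  proof (rule submat_eq)
    show "strict_mono_on {..<m} ((+) (n - m))" by (auto simp: strict_mono_on_def)
    show "(+) (n - m) ` {..<m} \<subseteq> {..<dim_row W}" "j \<le> dim_col W" using that ij by auto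
    fix r assume r: "r < dim_row W"
    have "r \<in> (+) (n - m) ` {..<m} \<longleftrightarrow> n - m \<le> r"
    proof
      assume "n - m \<le> r"
      then have "r = n - m + (r - (n - m))" "r - (n - m) < m" using r that by auto
      then show "r \<in> (+) (n - m) ` {..<m}" by blast
    qed auto
    then show "Suc r \<in> {n + 1 - m..n} \<longleftrightarrow> r \<in> (+) (n - m) ` {..<m}"
      using r that by auto
  qed
  have s: "submat ?X {n + 1 - (n - i)..n} {1..j} = mat (n - i) j (\<lambda>(a, b). ?X $$ (n - (n - i) + a, b))"
    "submat (adj_mat ?X) {n + 1 - (j - (n - i))..n} {1..j} =
      mat (j - (n - i)) j (\<lambda>(a, b). adj_mat ?X $$ (n - (j - (n - i)) + a, b))"
    by (rule sub; use ij adj_mat(1)[of ?X n] in simp)+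
  \<comment> \<open>Row \<open>a \<ge> n - i\<close> of the stacked matrix is row
    \<open>a - (n - i)\<close> of the lower block, and
    \<open>n - (j - (n - i)) + (a - (n - i)) = n - j + a\<close>, the index used in
    \<open>minor1\<close>.\<close>
  have "det (submat ?X {n + 1 - (n - i)..n} {1..j} @\<^sub>r submat (adj_mat ?X) {n + 1 - (j - (n - i))..n} {1..j}) =
      minor1 n ?X (adj_mat ?X) i j"
    unfolding minor1_def fdet_def append_rows_def s
    by (rule arg_cong[where f = det], rule eq_matI) (use False ij in auto)
  then show ?thesis using False ij by (simp add: J_def JM_def opp_def)
qed

lemma mp_eval_J:
  assumes \<phi>: "comm_ring_hom \<phi>" and ij: "i < n" "1 \<le> j" "j \<le> n"
  shows "mp_eval \<phi> a (J n (Suc i, j)) = JM n (mat n n (\<lambda>(p, q). a (Suc p, Suc q))) i j"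
proof -
  interpret comm_ring_hom "mp_eval \<phi> a" by (rule comm_ring_hom_mp_eval[OF \<phi>])
  have "map_mat (mp_eval \<phi> a) (generic_mat n) = mat n n (\<lambda>(p, q). a (Suc p, Suc q))"
    by (rule eq_matI) (auto simp: generic_mat_def mp_eval_var[OF \<phi>])
  then show ?thesis using hom_JM[of "generic_mat n" n i j] ij by (simp add: J_eq_JM)
qed

section \<open>Values of the generators on anti-triangular matrices\<close>

lemma anti_lowerD:
  assumes "anti_lower n Y"
  shows "Y \<in> carrier_mat n n" "i + j < n - 1 \<Longrightarrow> Y $$ (i, j) = 0"
  using assms by (auto simp: anti_lower_def)

lemma minor0_anti_lower:
  assumes Y: "anti_lower n Y" and j: "j \<le> n"
  shows "minor0 n Y (n - j) j = rev_sign j * (\<Prod>a<j. Y $$ (n - 1 - a, a))"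
proof -
  have "minor0 n Y (n - j) j = fdet j (\<lambda>a b. Y $$ (n - j + a, b))"
    unfolding minor0_def by (rule fdet_cong) auto
  also have "\<dots> = rev_sign j * (\<Prod>a<j. Y $$ (n - j + (j - 1 - a), a))"
    by (rule fdet_anti_lower) (use j anti_lowerD(2)[OF Y] in auto)
  also have "(\<Prod>a<j. Y $$ (n - j + (j - 1 - a), a)) = (\<Prod>a<j. Y $$ (n - 1 - a, a))"
    by (rule prod.cong) (use j in auto)
  finally show ?thesis .
qed

lemma det_anti_lower:
  assumes Y: "anti_lower n Y"
  shows "det Y = rev_sign n * (\<Prod>a<n. Y $$ (n - 1 - a, a))"
proof -
  have "det Y = minor0 n Y (n - n) n"
    unfolding minor0_def fdet_mat[OF anti_lowerD(1)[OF Y], symmetric] by (rule fdet_cong) auto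
  then show ?thesis using minor0_anti_lower[OF Y, of n] by simp
qed

text \<open>Column \<open>n - 1 - k\<close> of \<open>Y\<close> starts at row \<open>k\<close>.
  Hence \<open>adj_mat Y * Y = det Y\<close> can be solved for the entries of the adjugate from its
  last column backwards, with one new term at each step.\<close>

lemma adj_mat_anti_lower:
  fixes Y :: "'a::field mat"
  assumes Y: "anti_lower n Y" and nz: "\<And>a. a < n \<Longrightarrow> Y $$ (n - 1 - a, a) \<noteq> 0"
  shows "p < n \<Longrightarrow> k < n \<Longrightarrow> n \<le> p + k \<Longrightarrow> adj_mat Y $$ (p, k) = 0"
    and "k < n \<Longrightarrow> adj_mat Y $$ (n - 1 - k, k) = det Y / Y $$ (k, n - 1 - k)"
proof -
  let ?Z = "adj_mat Y"
  note car = anti_lowerD(1)[OF Y]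
  note adj = adj_mat[OF car]
  have prod: "(if p = n - 1 - k then det Y else 0) = ?Z $$ (p, k) * Y $$ (k, n - 1 - k)"
    if "p < n" "k < n" and z: "\<And>k'. k < k' \<Longrightarrow> k' < n \<Longrightarrow> ?Z $$ (p, k') = 0" for p k
  proof -
    have "(if p = n - 1 - k then det Y else 0) = (?Z * Y) $$ (p, n - 1 - k)"
      unfolding adj(3) using that by simp
    also have "\<dots> = (\<Sum>q<n. ?Z $$ (p, q) * Y $$ (q, n - 1 - k))"
      by (rule index_mult_sum) (use car adj that in auto)
    also have "\<dots> = (\<Sum>q\<in>{k}. ?Z $$ (p, q) * Y $$ (q, n - 1 - k))"
    proof (rule sum.mono_neutral_right; (intro ballI)?)
      fix q assume "q \<in> {..<n} - {k}"
      then show "?Z $$ (p, q) * Y $$ (q, n - 1 - k) = 0"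
        using z[of q] anti_lowerD(2)[OF Y, of q "n - 1 - k"] that by (cases "q < k") auto
    qed (use that in auto)
    finally show ?thesis by simp
  qed
  have zero: "?Z $$ (p, k) = 0" if "p < n" "k < n" "n \<le> p + k" for p k
    using that
  proof (induction "n - k" arbitrary: k rule: less_induct)
    case less
    have "?Z $$ (p, k') = 0" if "k < k'" "k' < n" for k'
      by (rule less.hyps) (use that less.prems in auto)
    from prod[OF less.prems(1,2) this] show ?case
      using nz[of "n - 1 - k"] less.prems by (auto split: if_splits)
  qed
  show "p < n \<Longrightarrow> k < n \<Longrightarrow> n \<le> p + k \<Longrightarrow> ?Z $$ (p, k) = 0" by (rule zero)
  assume k: "k < n"
  have "det Y = ?Z $$ (n - 1 - k, k) * Y $$ (k, n - 1 - k)"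
    using prod[of "n - 1 - k" k] zero[of "n - 1 - k"] k by auto
  then show "?Z $$ (n - 1 - k, k) = det Y / Y $$ (k, n - 1 - k)"
    using nz[of "n - 1 - k"] k by (simp add: field_simps)
qed

text \<open>The lower left corner minor of size \<open>r\<close> of the adjugate of an anti-triangular matrix with
  anti-diagonal entries \<open>y\<close>, listed by column.\<close>

definition adj_corner :: "nat \<Rightarrow> (nat \<Rightarrow> 'a::field) \<Rightarrow> nat \<Rightarrow> 'a" where
  "adj_corner n y r = rev_sign r * (\<Prod>a<r. (rev_sign n * (\<Prod>b<n. y b)) / y (n - 1 - a))"

lemma adj_corner_cong:
  "r \<le> n \<Longrightarrow> (\<And>b. b < n \<Longrightarrow> y b = z b) \<Longrightarrow> adj_corner n y r = adj_corner n z r"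
  unfolding adj_corner_def
  by (intro arg_cong2[where f = "(*)"] arg_cong2[where f = "(/)"] prod.cong refl) auto

lemma adj_corner_nonzero:
  "r \<le> n \<Longrightarrow> (\<And>b. b < n \<Longrightarrow> y b \<noteq> 0) \<Longrightarrow> adj_corner n y r \<noteq> 0"
  by (auto simp: adj_corner_def)

text \<open>The last \<open>r\<close> rows of the adjugate vanish from column \<open>r\<close> on,
  so the determinant splits into the lower left corner minor of the adjugate and a minor of
  \<open>Y\<close>.\<close>

lemma JM_anti_lower_block:
  fixes Y :: "'a::field mat"
  assumes Y: "anti_lower n Y" and nz: "\<And>a. a < n \<Longrightarrow> Y $$ (n - 1 - a, a) \<noteq> 0"
    and ij: "i < n" "j \<le> n" "n < i + j"
  defines "r \<equiv> i + j - n"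
  shows "JM n Y i j = (- 1) ^ ((n - i) * r) * adj_corner n (\<lambda>b. Y $$ (n - 1 - b, b)) r
           * fdet (n - i) (\<lambda>a b. Y $$ (i + a, r + b))"
proof -
  let ?Z = "adj_mat Y" and ?m = "n - i"
  let ?f = "\<lambda>a b. if a < ?m then Y $$ (i + a, b) else ?Z $$ (n - j + a, b)"
  note adj = adj_mat_anti_lower[OF Y nz]
  have j: "j = ?m + r" and r: "r \<le> n" using ij by (auto simp: r_def)
  have "JM n Y i j = fdet j ?f"
    using ij by (simp add: JM_def minor1_def)
  \<comment> \<open>Only the size is rewritten by \<open>j = ?m + r\<close>; \<open>?f\<close> keeps
    its own \<open>j\<close>.\<close>
  also have "\<dots> = fdet (?m + r) ?f"
    by (rule arg_cong[where f = "\<lambda>k. fdet k ?f"]) (rule j)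
  also have "\<dots> = (- 1) ^ (?m * r) * fdet r (\<lambda>a b. ?f (?m + a) b) * fdet ?m (\<lambda>a b. ?f a (r + b))"
    by (rule fdet_block_lower_right_zero) (use adj(1) ij r in \<open>auto simp: r_def\<close>)
  also have "fdet ?m (\<lambda>a b. ?f a (r + b)) = fdet ?m (\<lambda>a b. Y $$ (i + a, r + b))"
    by (rule fdet_cong) simp
  also have "fdet r (\<lambda>a b. ?f (?m + a) b) = rev_sign r * (\<Prod>a<r. ?f (?m + (r - 1 - a)) a)"
    by (rule fdet_anti_upper) (use adj(1) ij r in \<open>auto simp: r_def\<close>)
  also have "(\<Prod>a<r. ?f (?m + (r - 1 - a)) a) = (\<Prod>a<r. det Y / Y $$ (n - 1 - (n - 1 - a), n - 1 - a))"
  proof (rule prod.cong)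
    fix a assume a: "a \<in> {..<r}"
    have "n - j + (?m + (r - 1 - a)) = n - 1 - a" "n - 1 - (n - 1 - a) = a"
      using a ij by (auto simp: r_def)
    moreover have "?f (?m + (r - 1 - a)) a = ?Z $$ (n - j + (?m + (r - 1 - a)), a)"
      by (rule if_not_P) simp
    moreover have "a < n" using a r by simp
    ultimately show "?f (?m + (r - 1 - a)) a = det Y / Y $$ (n - 1 - (n - 1 - a), n - 1 - a)"
      using adj(2)[of a] by (simp only:)
  qed simp
  finally show ?thesis
    by (simp add: adj_corner_def det_anti_lower[OF Y])
qed

text \<open>Expansion of the minor of \<open>Y\<close> along its first row, whose last entry is
  \<open>Y $$ (i, j - 1)\<close>. Apart from the anti-diagonal in \<open>adj_corner\<close>, all
  other entries involved lie on diagonals closer to the lower left corner.\<close>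

lemma JM_anti_lower:
  fixes Y :: "'a::field mat"
  assumes Y: "anti_lower n Y" and nz: "\<And>a. a < n \<Longrightarrow> Y $$ (n - 1 - a, a) \<noteq> 0"
    and ij: "i < n" "j \<le> n" "n < i + j"
  defines "r \<equiv> i + j - n" and "m \<equiv> n - 1 - i"
  shows "JM n Y i j = (- 1) ^ (Suc m * r) * adj_corner n (\<lambda>b. Y $$ (n - 1 - b, b)) r *
           ((- 1) ^ m * Y $$ (i, j - 1) * fdet m (\<lambda>a b. Y $$ (Suc i + a, r + b)) +
            fdet_rest m (\<lambda>a b. Y $$ (i + a, r + b)))"
proof -
  have m: "n - i = Suc m" and j: "j - 1 = r + m" using ij by (auto simp: m_def r_def)
  have "JM n Y i j = (- 1) ^ (Suc m * r) * adj_corner n (\<lambda>b. Y $$ (n - 1 - b, b)) r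
      * fdet (Suc m) (\<lambda>a b. Y $$ (i + a, r + b))"
    using JM_anti_lower_block[OF Y nz ij] by (simp only: m r_def)
  then show ?thesis
    unfolding fdet_corner j by simp
qed

text \<open>The coefficient of \<open>Y $$ (i, j - 1)\<close> is a factor of the neighbouring
  generator one row down and one column to the left, which has the same \<open>i + j - n\<close>.
  For the last row it is the empty minor 1.\<close>

lemma JM_anti_lower_cofactor_nonzero:
  fixes Y :: "'a::field mat"
  assumes Y: "anti_lower n Y" and nz: "\<And>a. a < n \<Longrightarrow> Y $$ (n - 1 - a, a) \<noteq> 0"
    and ij: "i < n" "j \<le> n" "n < i + j"
    and J: "Suc i < n \<Longrightarrow> JM n Y (Suc i) (j - 1) \<noteq> 0"
  shows "fdet (n - 1 - i) (\<lambda>a b. Y $$ (Suc i + a, (i + j - n) + b)) \<noteq> 0"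
proof (cases "Suc i < n")
  case True
  then have "Suc i < n" "j - 1 \<le> n" "n < Suc i + (j - 1)" "Suc i + (j - 1) - n = i + j - n"
    using ij by auto
  then show ?thesis
    using J[OF True] JM_anti_lower_block[OF Y nz, of "Suc i" "j - 1"] by auto
qed simp

text \<open>The triangular system is solved: first the anti-diagonal, from ratios of prescribed
  values, then the entries below it, one diagonal after another from the lower left corner.\<close>

lemma exists_anti_lower_JM:
  fixes c :: "nat \<Rightarrow> nat \<Rightarrow> 'a::field"
  assumes c: "\<And>i j. i < n \<Longrightarrow> 1 \<le> j \<Longrightarrow> j \<le> n \<Longrightarrow> c i j \<noteq> 0"
  obtains Y where "anti_lower n Y" "det Y \<noteq> 0"
    "\<And>i j. i < n \<Longrightarrow> 1 \<le> j \<Longrightarrow> j \<le> n \<Longrightarrow> n \<le> i + j \<Longrightarrow> JM n Y i j = c i j"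
proof -
  \<comment> \<open>\<open>e j\<close> is the required product of the first \<open>j\<close>
    anti-diagonal entries, so these entries are the ratios \<open>y b\<close>. The value 1 at
    \<open>j = 0\<close> is the empty product.\<close>
  define e where "e j = (if j = 0 then 1 else rev_sign j * c (n - j) j)" for j
  define y where "y b = e (Suc b) / e b" for b
  have e: "e j \<noteq> 0" if "j \<le> n" for j
    using c[of "n - j" j] that by (simp add: e_def)
  then have y: "y b \<noteq> 0" if "b < n" for b
    using that by (simp add: y_def)
  have ye: "(\<Prod>b<j. y b) = e j" if "j \<le> n" for j
    using that by (induction j) (use e in \<open>auto simp: y_def e_def[of 0]\<close>)
  \<comment> \<open>The bounded quantity \<open>j + (n - i)\<close> is constant along diagonals and
    grows away from the lower left corner. At \<open>t = 0\<close> no generator is concerned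
    yet.\<close>
  have "\<exists>Y. anti_lower n Y \<and> (\<forall>b<n. Y $$ (n - 1 - b, b) = y b) \<and>
      (\<forall>i j. i < n \<longrightarrow> j \<le> n \<longrightarrow> n < i + j \<longrightarrow> j + (n - i) \<le> t \<longrightarrow> JM n Y i j = c i j)" for t
  proof (induction t)
    case 0
    let ?Y = "mat n n (\<lambda>(p, q). if p + q < n - 1 then 0 else y q)"
    have "anti_lower n ?Y" by (auto simp: anti_lower_def)
    then show ?case by (intro exI[of _ ?Y]) auto
  next
    case (Suc t)
    then obtain Y where Y: "anti_lower n Y" and Yy: "\<And>b. b < n \<Longrightarrow> Y $$ (n - 1 - b, b) = y b"
      and J: "\<And>i j. i < n \<Longrightarrow> j \<le> n \<Longrightarrow> n < i + j \<Longrightarrow> j + (n - i) \<le> t \<Longrightarrow> JM n Y i j = c i j"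
      by blast
    define r where "r i j = i + j - n" for i j
    define A where "A i j = (- 1) ^ (Suc (n - 1 - i) * r i j) * adj_corner n y (r i j)" for i j
    define B where "B i j = (- 1) ^ (n - 1 - i) * fdet (n - 1 - i) (\<lambda>a b. Y $$ (Suc i + a, r i j + b))" for i j
    define E where "E i j = fdet_rest (n - 1 - i) (\<lambda>a b. Y $$ (i + a, r i j + b))" for i j
    \<comment> \<open>All entries of the new diagonal below the anti-diagonal change at once: each
      solves \<open>A * (B * x + E) = c\<close>, where \<open>A\<close>, \<open>B\<close> and
      \<open>E\<close> involve only earlier diagonals and the anti-diagonal.\<close>
    define Y' where "Y' = mat n n (\<lambda>(p, q). if n < p + Suc q \<and> Suc q + (n - p) = Suc t
      then (c p (Suc q) / A p (Suc q) - E p (Suc q)) / B p (Suc q) else Y $$ (p, q))"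
    have Y': "anti_lower n Y'"
      using anti_lowerD[OF Y] by (auto simp: anti_lower_def Y'_def)
    have Yy': "Y' $$ (n - 1 - b, b) = y b" if "b < n" for b
      using that Yy by (simp add: Y'_def)
    have same: "Y' $$ (p, q) = Y $$ (p, q)" if "p < n" "q < n" "Suc q + (n - p) \<noteq> Suc t" for p q
      using that by (simp add: Y'_def)
    have nz: "Y $$ (n - 1 - a, a) \<noteq> 0" "Y' $$ (n - 1 - a, a) \<noteq> 0" if "a < n" for a
      using that y Yy Yy' by auto
    have corner: "adj_corner n (\<lambda>b. Y' $$ (n - 1 - b, b)) (r i j) = adj_corner n y (r i j)"
      "adj_corner n (\<lambda>b. Y $$ (n - 1 - b, b)) (r i j) = adj_corner n y (r i j)"
      if "i < n" "j \<le> n" for i j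
      by (rule adj_corner_cong; use that Yy Yy' in \<open>simp add: r_def\<close>)+
    have expand: "JM n Y' i j = A i j * (B i j * Y' $$ (i, j - 1) + E i j)"
      if ij: "i < n" "j \<le> n" "n < i + j" "j + (n - i) \<le> Suc t" for i j
    proof -
      have "fdet (n - 1 - i) (\<lambda>a b. Y' $$ (Suc i + a, r i j + b)) =
          fdet (n - 1 - i) (\<lambda>a b. Y $$ (Suc i + a, r i j + b))"
        by (rule fdet_cong, rule same) (use ij in \<open>auto simp: r_def\<close>)
      moreover have "fdet_rest (n - 1 - i) (\<lambda>a b. Y' $$ (i + a, r i j + b)) = E i j"
        unfolding E_def by (rule fdet_rest_cong, rule same) (use ij in \<open>auto simp: r_def\<close>)
      ultimately show ?thesis
        using JM_anti_lower[OF Y' nz(2) ij(1-3)] corner(1)[OF ij(1,2)]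
        by (simp add: A_def B_def r_def mult_ac)
    qed
    have "JM n Y' i j = c i j" if ij: "i < n" "j \<le> n" "n < i + j" "j + (n - i) \<le> Suc t" for i j
    proof (cases "j + (n - i) = Suc t")
      case True
      \<comment> \<open>The neighbouring generator already has its prescribed nonzero value, so the
        linear equation is solvable.\<close>
      have "JM n Y (Suc i) (j - 1) \<noteq> 0" if "Suc i < n"
        using J[of "Suc i" "j - 1"] c[of "Suc i" "j - 1"] that ij by simp
      then have "B i j \<noteq> 0"
        using JM_anti_lower_cofactor_nonzero[OF Y nz(1) ij(1-3)] by (simp add: B_def r_def)
      moreover have "A i j \<noteq> 0"
        unfolding A_def using adj_corner_nonzero[of "r i j" n y] y ij by (simp add: r_def)
      moreover have "Y' $$ (i, j - 1) = (c i j / A i j - E i j) / B i j"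
        using ij True by (cases j) (simp_all add: Y'_def)
      ultimately show ?thesis unfolding expand[OF ij] by simp
    next
      case False
      have "JM n Y i j = A i j * (B i j * Y $$ (i, j - 1) + E i j)"
        using JM_anti_lower[OF Y nz(1) ij(1-3)] corner(2)[OF ij(1,2)]
        by (simp add: A_def B_def E_def r_def mult_ac)
      also have "Y $$ (i, j - 1) = Y' $$ (i, j - 1)"
        using same[of i "j - 1"] ij False by simp
      also have "A i j * (B i j * Y' $$ (i, j - 1) + E i j) = JM n Y' i j"
        by (rule expand[OF ij, symmetric])
      finally show ?thesis using J[OF ij(1-3)] ij False by simp
    qed
    then show ?case using Y' Yy' by blast
  qed
  from this[of "2 * n"] obtain Y where Y: "anti_lower n Y" and Yy: "\<And>b. b < n \<Longrightarrow> Y $$ (n - 1 - b, b) = y b"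
    and J: "\<And>i j. i < n \<Longrightarrow> j \<le> n \<Longrightarrow> n < i + j \<Longrightarrow> j + (n - i) \<le> 2 * n \<Longrightarrow> JM n Y i j = c i j"
    by blast
  have "(\<Prod>b<j. Y $$ (n - 1 - b, b)) = e j" if "j \<le> n" for j
    using ye[OF that] Yy that by simp
  then have "minor0 n Y (n - j) j = c (n - j) j" if "1 \<le> j" "j \<le> n" for j
    using minor0_anti_lower[OF Y that(2)] that rev_sign_square[of j, where 'a = 'a]
    by (simp add: e_def flip: mult.assoc)
  then have "JM n Y i j = c i j" if "i < n" "1 \<le> j" "j \<le> n" "n \<le> i + j" for i j
  proof (cases "n < i + j")
    case False
    then have "i = n - j" using that by simp
    then show ?thesis using \<open>\<And>j. 1 \<le> j \<Longrightarrow> j \<le> n \<Longrightarrow> minor0 n Y (n - j) j = c (n - j) j\<close>[of j] that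
      by (simp add: JM_def)
  qed (use J that in auto)
  moreover have "det Y \<noteq> 0" using det_anti_lower[OF Y] Yy y by simp
  ultimately show ?thesis using Y that by blast
qed

lemma JM_uni_conj_anti_lower:
  fixes Y :: "'a::field mat"
  assumes a: "uni (<) n a" "uni (<) n h" "a * h = 1\<^sub>m n" "h * a = 1\<^sub>m n"
    and Y: "anti_lower n Y" "det Y \<noteq> 0" and ij: "i < n" "1 \<le> j" "j \<le> n"
  shows "i + j \<le> n \<Longrightarrow> JM n (a * Y * h) i j = a $$ (i, n - j) * JM n Y (n - j) j"
    and "n \<le> i + j \<Longrightarrow> JM n (a * Y * h) i j = JM n Y i j"
proof -
  note car = uniD(1)[OF a(1)] uniD(1)[OF a(2)] anti_lowerD(1)[OF Y(1)]
  assume "i + j \<le> n"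
  moreover from this have "minor0 n (a * Y * h) i j = a $$ (i, n - j) * minor0 n Y (n - j) j"
    using minor0_mult_uni[OF a(2), of "a * Y" j i] minor0_uni_anti_lower[OF a(1) Y(1)] ij car by simp
  ultimately show "JM n (a * Y * h) i j = a $$ (i, n - j) * JM n Y (n - j) j"
    using ij by (simp add: JM_def)
next
  assume "n \<le> i + j"
  then show "JM n (a * Y * h) i j = JM n Y i j"
    by (intro JM_conj) (use assms anti_lowerD(1)[OF Y(1)] in auto)
qed

text \<open>Conjugation by \<open>a\<close> adjusts the values above the anti-diagonal without
  disturbing the others. The lemma serves both the nonvanishing of each generator and algebraic
  independence.\<close>

lemma exists_JM:
  fixes c :: "nat \<Rightarrow> nat \<Rightarrow> 'a::field"
  assumes c: "\<And>i j. i < n \<Longrightarrow> 1 \<le> j \<Longrightarrow> j \<le> n \<Longrightarrow> c i j \<noteq> 0"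
  obtains M where "M \<in> carrier_mat n n" "\<And>i j. i < n \<Longrightarrow> 1 \<le> j \<Longrightarrow> j \<le> n \<Longrightarrow> JM n M i j = c i j"
proof -
  obtain Y where Y: "anti_lower n Y" "det Y \<noteq> 0"
    and J: "\<And>i j. i < n \<Longrightarrow> 1 \<le> j \<Longrightarrow> j \<le> n \<Longrightarrow> n \<le> i + j \<Longrightarrow> JM n Y i j = c i j"
    using exists_anti_lower_JM[of n c] c by blast
  \<comment> \<open>Chosen so that \<open>a $$ (i, k) * c k (n - k) = c i (n - k)\<close> for
    \<open>i < k\<close>.\<close>
  define a where "a = mat n n (\<lambda>(i, k). if i < k then c i (n - k) / c k (n - k) else if i = k then 1 else 0)"
  have a: "uni (<) n a" by (auto simp: uni_def a_def)
  note adj = uni_adj[OF a]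
  have h: "uni (<) n (adj_mat a)"
    by (rule uni_inverse[OF _ _ a]) (use adj in auto)
  have "JM n (a * Y * adj_mat a) i j = c i j" if ij: "i < n" "1 \<le> j" "j \<le> n" for i j
  proof (cases "n \<le> i + j")
    case True
    then show ?thesis using JM_uni_conj_anti_lower(2)[OF a h adj(2,3) Y ij] J[OF ij] by simp
  next
    case False
    then show ?thesis
      using JM_uni_conj_anti_lower(1)[OF a h adj(2,3) Y ij] J[of "n - j" j] c[of "n - j" j] ij
      by (simp add: a_def)
  qed
  moreover have "a * Y * adj_mat a \<in> carrier_mat n n"
    using adj(1) uniD(1)[OF a] anti_lowerD(1)[OF Y(1)] by simp
  ultimately show ?thesis using that by blast
qed

section \<open>Subfields, Gaussian elimination and the vanishing of polynomials\<close>

context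
  fixes L :: "'a::field set"
  assumes L: "is_subfield L"
begin

lemma subfield_0: "0 \<in> L" and subfield_1: "1 \<in> L"
  and subfield_add: "x \<in> L \<Longrightarrow> y \<in> L \<Longrightarrow> x + y \<in> L"
  and subfield_mult: "x \<in> L \<Longrightarrow> y \<in> L \<Longrightarrow> x * y \<in> L"
  and subfield_uminus: "x \<in> L \<Longrightarrow> - x \<in> L"
  and subfield_inverse: "x \<in> L \<Longrightarrow> inverse x \<in> L"
  using L by (auto simp: is_subfield_def)

lemma subfield_diff: "x \<in> L \<Longrightarrow> y \<in> L \<Longrightarrow> x - y \<in> L"
  using subfield_add[of x "- y"] subfield_uminus by simp

lemma subfield_divide: "x \<in> L \<Longrightarrow> y \<in> L \<Longrightarrow> x / y \<in> L"
  unfolding divide_inverse by (intro subfield_mult subfield_inverse)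

lemma subfield_sum: "(\<And>x. x \<in> A \<Longrightarrow> f x \<in> L) \<Longrightarrow> sum f A \<in> L"
  by (induction A rule: infinite_finite_induct) (simp_all add: subfield_0 subfield_add)

lemma subfield_prod: "(\<And>x. x \<in> A \<Longrightarrow> f x \<in> L) \<Longrightarrow> prod f A \<in> L"
  by (induction A rule: infinite_finite_induct) (simp_all add: subfield_1 subfield_mult)

lemma subfield_power: "x \<in> L \<Longrightarrow> x ^ k \<in> L"
  by (induction k) (simp_all add: subfield_1 subfield_mult)

lemma subfield_signof: "signof p \<in> L"
  using subfield_1 subfield_uminus by (simp add: sign_def)

lemma subfield_rev_sign: "rev_sign j \<in> L"
  unfolding rev_sign_def by (rule subfield_signof)

lemma subfield_neg_one_power: "(- 1) ^ k \<in> L"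
  by (intro subfield_power subfield_uminus subfield_1)

lemma subfield_det:
  assumes A: "A \<in> carrier_mat n n" "\<And>i j. i < n \<Longrightarrow> j < n \<Longrightarrow> A $$ (i, j) \<in> L"
  shows "det A \<in> L"
  unfolding det_def'[OF A(1)]
proof (intro subfield_sum subfield_mult subfield_prod subfield_signof)
  fix p i assume "p \<in> {p. p permutes {0..<n}}" "i \<in> {0..<n}"
  then show "A $$ (i, p i) \<in> L" using A(2)[of i "p i"] permutes_in_image[of p "{0..<n}" i] by simp
qed

lemma subfield_fdet: "(\<And>a b. a < j \<Longrightarrow> b < j \<Longrightarrow> f a b \<in> L) \<Longrightarrow> fdet j f \<in> L"
  unfolding fdet_def by (rule subfield_det) auto

lemma subfield_cofactor:
  assumes "A \<in> carrier_mat n n" "\<And>i j. i < n \<Longrightarrow> j < n \<Longrightarrow> A $$ (i, j) \<in> L"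
  shows "cofactor A i j \<in> L"
  unfolding cofactor_def
  by (intro subfield_mult subfield_neg_one_power subfield_det[of _ "n - 1"])
    (use assms in \<open>auto simp: mat_delete_def\<close>)

lemma subfield_adj_mat:
  assumes "A \<in> carrier_mat n n" "\<And>i j. i < n \<Longrightarrow> j < n \<Longrightarrow> A $$ (i, j) \<in> L"
  shows "i < n \<Longrightarrow> j < n \<Longrightarrow> adj_mat A $$ (i, j) \<in> L"
  using subfield_cofactor[OF assms] assms(1) by (simp add: adj_mat_def)

lemma subfield_mult_mat:
  assumes "A \<in> carrier_mat n n" "\<And>i j. i < n \<Longrightarrow> j < n \<Longrightarrow> A $$ (i, j) \<in> L"
    and "B \<in> carrier_mat n n" "\<And>i j. i < n \<Longrightarrow> j < n \<Longrightarrow> B $$ (i, j) \<in> L"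
  shows "i < n \<Longrightarrow> j < n \<Longrightarrow> (A * B) $$ (i, j) \<in> L"
  unfolding index_mult_sum[OF assms(1,3)]
  by (intro subfield_sum subfield_mult) (use assms in auto)

lemma subfield_fdet_rest:
  assumes "\<And>a b. a \<le> m \<Longrightarrow> b \<le> m \<Longrightarrow> (a, b) \<noteq> (0, m) \<Longrightarrow> f a b \<in> L"
  shows "fdet_rest m f \<in> L"
proof -
  \<comment> \<open>The top right entry does not enter \<open>fdet_rest\<close>. Replacing it by 0
    puts all entries into \<open>L\<close>.\<close>
  let ?g = "\<lambda>a b. if (a, b) = (0, m) then 0 else f a b"
  have "fdet_rest m f = fdet_rest m ?g" by (rule fdet_rest_cong) auto
  also have "\<dots> \<in> L"
    unfolding fdet_rest_def
    by (intro subfield_sum subfield_mult subfield_cofactor[of _ "Suc m"])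
      (use assms subfield_0 in auto)
  finally show ?thesis .
qed

lemma subfield_mp_eval:
  assumes "\<And>c. \<phi> c \<in> L" "\<And>v. v \<in> mp_vars p \<Longrightarrow> a v \<in> L"
  shows "mp_eval \<phi> a p \<in> L"
  unfolding mp_eval_def
  by (intro subfield_sum subfield_mult subfield_prod subfield_power assms) (auto simp: mp_vars_def)

text \<open>The triangular system read as formulas for the entries: quotients of anti-diagonal
  products give the anti-diagonal, and each entry below it is \<open>(J / A - E) / B\<close>, with
  \<open>B\<close> and \<open>E\<close> in \<open>L\<close> by induction from the lower left
  corner.\<close>

lemma anti_lower_entries_in_subfield:
  assumes Y: "anti_lower n Y"
    and J: "\<And>i j. i < n \<Longrightarrow> 1 \<le> j \<Longrightarrow> j \<le> n \<Longrightarrow> n \<le> i + j \<Longrightarrow> JM n Y i j \<in> L \<and> JM n Y i j \<noteq> 0"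
    and pq: "p < n" "q < n"
  shows "Y $$ (p, q) \<in> L"
proof -
  let ?y = "\<lambda>b. Y $$ (n - 1 - b, b)"
  have P: "(\<Prod>a<j. ?y a) \<in> L \<and> (\<Prod>a<j. ?y a) \<noteq> 0" if j: "j \<le> n" for j
  proof (cases "j = 0")
    case False
    then have R: "rev_sign j * (\<Prod>a<j. ?y a) \<in> L" "rev_sign j * (\<Prod>a<j. ?y a) \<noteq> 0"
      using minor0_anti_lower[OF Y j] J[of "n - j" j] j by (simp_all add: JM_def)
    have "rev_sign j * (rev_sign j * (\<Prod>a<j. ?y a)) \<in> L"
      by (intro subfield_mult[OF _ R(1)] subfield_rev_sign)
    then have "(\<Prod>a<j. ?y a) \<in> L"
      by (simp only: rev_sign_square mult.assoc[symmetric] mult_1)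
    with R(2) show ?thesis by auto
  qed (simp add: subfield_1)
  have nz: "?y b \<noteq> 0" if "b < n" for b using P[of n] that by auto
  have yL: "?y b \<in> L" if "b < n" for b
  proof -
    have "?y b = (\<Prod>a<Suc b. ?y a) / (\<Prod>a<b. ?y a)" using P[of b] that by simp
    also have "\<dots> \<in> L" by (intro subfield_divide) (use P[of b] P[of "Suc b"] that in auto)
    finally show ?thesis .
  qed
  show ?thesis
    using pq
  proof (induction "Suc q + (n - p)" arbitrary: p q rule: less_induct)
    case less
    consider "p + q < n - 1" | "p = n - 1 - q" | "n < p + Suc q" using less.prems by linarith
    then show ?case
    proof cases
      case 3
      define r m j where "r = p + Suc q - n" and "m = n - 1 - p" and "j = Suc q"
      define A where "A = (- 1) ^ (Suc m * r) * adj_corner n ?y r"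
      define B where "B = (- 1) ^ m * fdet m (\<lambda>a b. Y $$ (Suc p + a, r + b))"
      define E where "E = fdet_rest m (\<lambda>a b. Y $$ (p + a, r + b))"
      have eq: "JM n Y p j = A * (B * Y $$ (p, q) + E)"
        using JM_anti_lower[OF Y nz, of p "Suc q"] 3 less.prems
        by (simp add: A_def B_def E_def r_def m_def j_def mult_ac)
      have "A \<noteq> 0"
        unfolding A_def using adj_corner_nonzero[of r n ?y] nz 3 less.prems by (simp add: r_def)
      moreover have "A \<in> L"
        unfolding A_def adj_corner_def
        by (intro subfield_mult subfield_neg_one_power subfield_rev_sign subfield_prod subfield_divide yL)
          (use less.prems in \<open>auto simp: r_def\<close>)
      moreover have "B \<noteq> 0"
        using JM_anti_lower_cofactor_nonzero[OF Y nz, of p j] J[of "Suc p" q] 3 less.prems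
        by (auto simp: B_def j_def m_def r_def)
      moreover have "B \<in> L"
        unfolding B_def
        by (intro subfield_mult subfield_neg_one_power subfield_fdet less.hyps)
          (use 3 less.prems in \<open>auto simp: r_def m_def\<close>)
      moreover have "E \<in> L"
        unfolding E_def
        by (intro subfield_fdet_rest less.hyps) (use 3 less.prems in \<open>auto simp: r_def m_def\<close>)
      moreover have "JM n Y p j \<in> L" using J[of p j] 3 less.prems by (simp add: j_def)
      moreover have "Y $$ (p, q) = (JM n Y p j / A - E) / B"
        using eq \<open>A \<noteq> 0\<close> \<open>B \<noteq> 0\<close> by simp
      ultimately show ?thesis by (simp add: subfield_diff subfield_divide)
    qed (use anti_lowerD(2)[OF Y] subfield_0 yL less.prems in auto)
  qed
qed

end

section \<open>Gaussian elimination to anti-triangular form\<close>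

lemma row_solve:
  fixes C :: "'a::field mat"
  assumes C: "C \<in> carrier_mat m m" "det C \<noteq> 0"
  shows "\<exists>v. \<forall>b<m. (\<Sum>a<m. v a * C $$ (a, b)) = x b"
proof -
  note adj = adj_mat[OF C(1)]
  let ?v = "\<lambda>a. (\<Sum>k<m. x k * adj_mat C $$ (k, a)) / det C"
  have "(\<Sum>a<m. ?v a * C $$ (a, b)) = x b" if b: "b < m" for b
  proof -
    have "(\<Sum>a<m. ?v a * C $$ (a, b)) = (\<Sum>a<m. \<Sum>k<m. x k * (adj_mat C $$ (k, a) * C $$ (a, b))) / det C"
      by (simp add: sum_divide_distrib sum_distrib_right sum_distrib_left mult_ac)
    also have "\<dots> = (\<Sum>k<m. x k * (adj_mat C * C) $$ (k, b)) / det C"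
      by (subst sum.swap) (use b in \<open>simp add: index_mult_sum[OF adj(1) C(1)] sum_distrib_left del: index_mult_mat(1)\<close>)
    also have "\<dots> = (\<Sum>k<m. if k = b then x k * det C else 0) / det C"
      unfolding adj(3) using b by (intro arg_cong2[where f = "(/)"] sum.cong) auto
    finally show ?thesis using b C(2) by simp
  qed
  then show ?thesis by (intro exI[of _ ?v] allI impI)
qed

text \<open>Row \<open>i\<close> is cleared in its first \<open>n - 1 - i\<close> columns by a
  combination of the rows below it. The determinant of this linear system is an anti-diagonal
  generator, hence nonzero.\<close>

lemma gauss_anti_lower:
  fixes X :: "'a::field mat"
  assumes X: "X \<in> carrier_mat n n" and J: "\<And>j. 1 \<le> j \<Longrightarrow> j \<le> n \<Longrightarrow> JM n X (n - j) j \<noteq> 0"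
  obtains h where "uni (<) n h" "anti_lower n (h * X)"
proof -
  have "\<exists>v. \<forall>b<n - 1 - i. (\<Sum>a<n - 1 - i. v a * X $$ (Suc i + a, b)) = - X $$ (i, b)" if i: "i < n" for i
  proof -
    let ?m = "n - 1 - i"
    let ?C = "mat ?m ?m (\<lambda>(a, b). X $$ (Suc i + a, b))"
    have "det ?C \<noteq> 0"
    proof (cases "?m = 0")
      case False
      then have ni: "n - ?m = Suc i" by simp
      have "JM n X (n - ?m) ?m = fdet ?m (\<lambda>a b. X $$ (n - ?m + a, b))"
        unfolding JM_def minor0_def using False by (simp, intro fdet_cong) auto
      then show ?thesis using J[of ?m] False unfolding ni by (simp add: fdet_def)
    qed simp
    then show ?thesis using row_solve[of ?C ?m "\<lambda>b. - X $$ (i, b)"] by auto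
  qed
  then obtain v where v: "\<And>i b. i < n \<Longrightarrow> b < n - 1 - i \<Longrightarrow>
      (\<Sum>a<n - 1 - i. v i a * X $$ (Suc i + a, b)) = - X $$ (i, b)" by metis
  define h where "h = mat n n (\<lambda>(i, k). if k = i then 1 else if i < k then v i (k - Suc i) else 0)"
  have h: "uni (<) n h" by (auto simp: uni_def h_def)
  have "(h * X) $$ (i, b) = 0" if ib: "i + b < n - 1" for i b
  proof -
    have "(h * X) $$ (i, b) = (\<Sum>k<n. h $$ (i, k) * X $$ (k, b))"
      by (rule index_mult_sum) (use uniD(1)[OF h] X ib in auto)
    also have "\<dots> = (\<Sum>k\<in>insert i ((+) (Suc i) ` {..<n - 1 - i}). h $$ (i, k) * X $$ (k, b))"
    proof (intro sum.mono_neutral_right ballI)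
      show "insert i ((+) (Suc i) ` {..<n - 1 - i}) \<subseteq> {..<n}" using ib by auto
      fix k assume k: "k \<in> {..<n} - insert i ((+) (Suc i) ` {..<n - 1 - i})"
      have "k < i"
      proof (rule ccontr)
        assume "\<not> k < i"
        then have "k = Suc i + (k - Suc i)" "k - Suc i \<in> {..<n - 1 - i}" using k by auto
        then show False using k by blast
      qed
      then show "h $$ (i, k) * X $$ (k, b) = 0" using ib by (simp add: h_def)
    qed simp
    also have "\<dots> = h $$ (i, i) * X $$ (i, b) + (\<Sum>k\<in>(+) (Suc i) ` {..<n - 1 - i}. h $$ (i, k) * X $$ (k, b))"
      by (rule sum.insert) auto
    also have "(\<Sum>k\<in>(+) (Suc i) ` {..<n - 1 - i}. h $$ (i, k) * X $$ (k, b)) =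
        (\<Sum>a<n - 1 - i. h $$ (i, Suc i + a) * X $$ (Suc i + a, b))"
      by (simp only: sum.reindex inj_on_add o_def)
    also have "\<dots> = (\<Sum>a<n - 1 - i. v i a * X $$ (Suc i + a, b))"
      by (rule sum.cong) (use ib in \<open>auto simp: h_def\<close>)
    finally show ?thesis using v[of i b] ib by (simp add: h_def)
  qed
  then have "anti_lower n (h * X)" using uniD(1)[OF h] X by (simp add: anti_lower_def del: index_mult_mat(1))
  with h show ?thesis by (rule that)
qed

text \<open>Expansion in powers of \<open>v\<close> with coefficients in the remaining variables,
  recorded only through evaluation.\<close>

lemma mp_eval_split_var:
  fixes p :: "('v, 'k::field) mpoly"
  assumes V: "finite V" "v \<notin> V" "mp_vars p \<subseteq> insert v V"
  obtains q :: "nat \<Rightarrow> ('v, 'k) mpoly" and K where "finite K"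
    "\<And>k. mp_vars (q k) \<subseteq> V" "\<And>a. mp_eval (\<lambda>c. c) a p = (\<Sum>k\<in>K. mp_eval (\<lambda>c. c) a (q k) * a v ^ k)"
    "p \<noteq> 0 \<Longrightarrow> \<exists>k\<in>K. q k \<noteq> 0"
proof -
  have id: "comm_ring_hom (\<lambda>c::'k. c)" by unfold_locales auto
  define M where "M k = {m \<in> Poly_Mapping.keys p. Poly_Mapping.lookup m v = k}" for k
  define q where "q k = (\<Sum>m\<in>M k. Poly_Mapping.single (m - Poly_Mapping.single v k) (Poly_Mapping.lookup p m))" for k
  define K where "K = (\<lambda>m. Poly_Mapping.lookup m v) ` Poly_Mapping.keys p"
  have lk: "Poly_Mapping.lookup (m - Poly_Mapping.single v k) u = (if u = v then 0 else Poly_Mapping.lookup m u)"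
    if "m \<in> M k" for m k u
    using that by (auto simp: M_def lookup_minus lookup_single when_def)
  have keysm: "Poly_Mapping.keys m \<subseteq> insert v V" if "m \<in> Poly_Mapping.keys p" for m
    using V(3) that by (auto simp: mp_vars_def)
  have keys: "Poly_Mapping.keys (m - Poly_Mapping.single v k) \<subseteq> V" if "m \<in> M k" for m k
  proof
    fix u assume "u \<in> Poly_Mapping.keys (m - Poly_Mapping.single v k)"
    then have "u \<noteq> v" "u \<in> Poly_Mapping.keys m" using lk[OF that] by (auto simp: in_keys_iff split: if_splits)
    then show "u \<in> V" using keysm[of m] that by (auto simp: M_def)
  qed
  have "finite K" by (simp add: K_def)
  moreover have "mp_vars (q k) \<subseteq> V" for k
    unfolding q_def
    by (rule mp_vars_sum) (use keys in \<open>auto simp: mp_vars_def split: if_splits\<close>)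
  moreover have "mp_eval (\<lambda>c. c) a p = (\<Sum>k\<in>K. mp_eval (\<lambda>c. c) a (q k) * a v ^ k)" for a
  proof -
    have term_eq: "Poly_Mapping.lookup p m * (\<Prod>u\<in>Poly_Mapping.keys m. a u ^ Poly_Mapping.lookup m u) =
        mp_eval (\<lambda>c. c) a (Poly_Mapping.single (m - Poly_Mapping.single v k) (Poly_Mapping.lookup p m)) * a v ^ k"
      if m: "m \<in> M k" for m k
    proof -
      have "(\<Prod>u\<in>Poly_Mapping.keys m. a u ^ Poly_Mapping.lookup m u) =
          (\<Prod>u\<in>insert v V. a u ^ Poly_Mapping.lookup m u)"
        by (rule monom_eval_superset) (use V keysm m in \<open>auto simp: M_def\<close>)
      also have "\<dots> = a v ^ k * (\<Prod>u\<in>V. a u ^ Poly_Mapping.lookup m u)"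
        using V m by (simp add: M_def)
      also have "(\<Prod>u\<in>V. a u ^ Poly_Mapping.lookup m u) =
          (\<Prod>u\<in>V. a u ^ Poly_Mapping.lookup (m - Poly_Mapping.single v k) u)"
        by (rule prod.cong) (use V lk[OF m] in auto)
      also have "\<dots> = (\<Prod>u\<in>Poly_Mapping.keys (m - Poly_Mapping.single v k).
          a u ^ Poly_Mapping.lookup (m - Poly_Mapping.single v k) u)"
        by (rule monom_eval_superset[symmetric]) (use V keys[OF m] in auto)
      finally show ?thesis by (simp add: mp_eval_single[OF id])
    qed
    have "mp_eval (\<lambda>c. c) a p =
        (\<Sum>k\<in>K. \<Sum>m\<in>M k. Poly_Mapping.lookup p m * (\<Prod>u\<in>Poly_Mapping.keys m. a u ^ Poly_Mapping.lookup m u))"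
      unfolding mp_eval_def K_def M_def by (rule sum.image_gen) simp
    also have "\<dots> = (\<Sum>k\<in>K. mp_eval (\<lambda>c. c) a (q k) * a v ^ k)"
      unfolding q_def mp_eval_sum[OF id] sum_distrib_right
      by (intro sum.cong refl term_eq)
    finally show ?thesis .
  qed
  moreover have "\<exists>k\<in>K. q k \<noteq> 0" if "p \<noteq> 0"
  proof -
    have "Poly_Mapping.keys p \<noteq> {}" using that by simp
    then obtain m where m: "m \<in> Poly_Mapping.keys p" by (meson all_not_in_conv)
    let ?k = "Poly_Mapping.lookup m v"
    \<comment> \<open>Monomials with the same exponent of \<open>v\<close> stay distinct when that
      power is removed, so nothing cancels in \<open>q ?k\<close>.\<close>
    have inj: "m' = m" if "m' \<in> M ?k" "m' - Poly_Mapping.single v ?k = m - Poly_Mapping.single v ?k" for m'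
    proof (rule poly_mapping_eqI)
      fix u show "Poly_Mapping.lookup m' u = Poly_Mapping.lookup m u"
        using lk[of m' ?k u] lk[of m ?k u] that m by (cases "u = v") (auto simp: M_def)
    qed
    have "Poly_Mapping.lookup (q ?k) (m - Poly_Mapping.single v ?k) = (\<Sum>m'\<in>M ?k. if m' = m then Poly_Mapping.lookup p m' else 0)"
      unfolding q_def lookup_sum
    proof (rule sum.cong[OF refl])
      fix m' assume "m' \<in> M ?k"
      then show "Poly_Mapping.lookup (Poly_Mapping.single (m' - Poly_Mapping.single v ?k) (Poly_Mapping.lookup p m'))
          (m - Poly_Mapping.single v ?k) = (if m' = m then Poly_Mapping.lookup p m' else 0)"
        using inj[of m'] by (cases "m' = m") (auto simp: lookup_single when_def)
    qed
    also have "\<dots> = Poly_Mapping.lookup p m"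
      using m by (simp add: M_def)
    finally have "q ?k \<noteq> 0" using m by (auto simp: in_keys_iff)
    then show ?thesis using m by (auto simp: K_def)
  qed
  ultimately show ?thesis by (rule that)
qed

text \<open>Induction on the variables: a point where one coefficient does not vanish leaves a
  nonzero univariate polynomial, which has finitely many roots. The set \<open>A\<close> will be the
  constants inside the function field, or the nonzero scalars.\<close>

lemma mp_eval_nonzero_point:
  fixes p :: "('v, 'k::field) mpoly"
  assumes A: "infinite A" and p: "p \<noteq> 0"
  shows "\<exists>a. range a \<subseteq> A \<and> mp_eval (\<lambda>c. c) a p \<noteq> 0"
proof -
  have id: "comm_ring_hom (\<lambda>c::'k. c)" by unfold_locales auto
  have "\<exists>a. range a \<subseteq> A \<and> mp_eval (\<lambda>c. c) a p \<noteq> 0" if "finite V" "mp_vars p \<subseteq> V" "p \<noteq> 0" for V and p :: "('v, 'k) mpoly"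
    using that
  proof (induction V arbitrary: p rule: finite_induct)
    case empty
    then have keys: "Poly_Mapping.keys p \<subseteq> {0}" by (auto simp: mp_vars_def)
    have "mp_eval (\<lambda>c. c) a p = Poly_Mapping.lookup p 0" for a
      using mp_eval_superset[OF _ keys, of "\<lambda>c. c" a] by simp
    moreover have "Poly_Mapping.lookup p 0 \<noteq> 0"
      using keys empty.prems(2) by (metis in_keys_iff keys_eq_empty subset_singletonD singletonI)
    moreover obtain x where "x \<in> A" using A by (metis ex_in_conv finite.emptyI)
    ultimately show ?case by (intro exI[of _ "\<lambda>_. x"]) auto
  next
    case (insert v V)
    obtain K q where q: "finite K" "\<And>k. mp_vars (q k) \<subseteq> V"
      "\<And>a. mp_eval (\<lambda>c. c) a p = (\<Sum>k\<in>K. mp_eval (\<lambda>c. c) a (q k) * a v ^ k)"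
      "p \<noteq> 0 \<Longrightarrow> \<exists>k\<in>K. q k \<noteq> 0"
      by (rule mp_eval_split_var[OF insert.hyps insert.prems(1)]) (rule that)
    obtain k where k: "k \<in> K" "q k \<noteq> 0" using q(4) insert.prems by blast
    obtain a where a: "range a \<subseteq> A" "mp_eval (\<lambda>c. c) a (q k) \<noteq> 0"
      using insert.IH[OF q(2) k(2)] by blast
    define P where "P = (\<Sum>k\<in>K. Polynomial.monom (mp_eval (\<lambda>c. c) a (q k)) k)"
    have "coeff P k = mp_eval (\<lambda>c. c) a (q k)"
      using q(1) k(1) by (simp add: P_def coeff_sum)
    then have "P \<noteq> 0" using a(2) by auto
    then have "finite {x. poly P x = 0}" by (rule poly_roots_finite)
    then obtain x where x: "x \<in> A" "poly P x \<noteq> 0"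
      using A by (metis (mono_tags, lifting) finite_subset mem_Collect_eq subsetI)
    have "mp_eval (\<lambda>c. c) (a(v := x)) (q k) = mp_eval (\<lambda>c. c) a (q k)" for k
      by (rule mp_eval_cong) (use q(2)[of k] insert.hyps in auto)
    then have "mp_eval (\<lambda>c. c) (a(v := x)) p = poly P x"
      unfolding q(3) by (simp add: P_def poly_sum poly_monom)
    with x(2) have "mp_eval (\<lambda>c. c) (a(v := x)) p \<noteq> 0" by (simp only: not_False_eq_True)
    moreover have "range (a(v := x)) \<subseteq> A" using a(1) x(1) by auto
    ultimately show ?case by blast
  qed
  moreover have "finite (mp_vars p)" by (simp add: mp_vars_def)
  ultimately show ?thesis using p by blast
qed

section \<open>Density of the rational points of the unipotent radical\<close>

definition pt :: "'a mat \<Rightarrow> nat \<times> nat \<Rightarrow> 'a" where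
  "pt M = (\<lambda>(i, j). entry M i j)"

lemma mat_pt: "M \<in> carrier_mat n n \<Longrightarrow> mat n n (\<lambda>(p, q). pt M (Suc p, Suc q)) = M"
  by (rule eq_matI) (auto simp: pt_def entry_def)

lemma pt_map_mat: "M \<in> carrier_mat n n \<Longrightarrow> v \<in> {1..n} \<times> {1..n} \<Longrightarrow> pt (map_mat \<phi> M) v = \<phi> (pt M v)"
  by (auto simp: pt_def entry_def)

lemma comm_ring_hom_id: "comm_ring_hom (\<lambda>c. c)"
  by unfold_locales auto

lemma mp_vars_mp_eval:
  assumes "\<And>c. mp_vars (\<phi> c) \<subseteq> V" "\<And>v. mp_vars (b v) \<subseteq> V"
  shows "mp_vars (mp_eval \<phi> b p) \<subseteq> V"
  unfolding mp_eval_def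
proof (rule mp_vars_sum)
  fix m
  have "mp_vars (\<Prod>v\<in>Poly_Mapping.keys m. b v ^ Poly_Mapping.lookup m v) \<subseteq> V"
    by (intro mp_vars_prod mp_vars_power assms)
  then show "mp_vars (\<phi> (Poly_Mapping.lookup p m) * (\<Prod>v\<in>Poly_Mapping.keys m. b v ^ Poly_Mapping.lookup m v)) \<subseteq> V"
    by (intro order_trans[OF mp_vars_mult] Un_least assms(1))
qed

text \<open>Substituting 0 for every variable out of range leaves the generic matrix, and with it
  the generator, unchanged.\<close>

lemma mp_vars_J:
  assumes ij: "i < n" "1 \<le> j" "j \<le> n"
  shows "mp_vars (J n (Suc i, j) :: (nat \<times> nat, 'k::field) mpoly) \<subseteq> {1..n} \<times> {1..n}"
proof -
  let ?b = "\<lambda>v. if v \<in> {1..n} \<times> {1..n} then mp_var v else 0 :: (nat \<times> nat, 'k) mpoly"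
  have "mat n n (\<lambda>(p, q). ?b (Suc p, Suc q)) = generic_mat n"
    by (rule eq_matI) (auto simp: generic_mat_def)
  then have "J n (Suc i, j) = mp_eval mp_const ?b (J n (Suc i, j))"
    using mp_eval_J[OF comm_ring_hom_mp_const ij, of ?b] J_eq_JM[OF ij, where 'k = 'k] by simp
  also have "mp_vars \<dots> \<subseteq> {1..n} \<times> {1..n}"
    by (rule mp_vars_mp_eval) auto
  finally show ?thesis .
qed

lemma J_nonzero:
  assumes ij: "i < n" "1 \<le> j" "j \<le> n"
  shows "J n (Suc i, j) \<noteq> (0 :: (nat \<times> nat, 'k::field) mpoly)"
proof
  assume "J n (Suc i, j) = (0 :: (nat \<times> nat, 'k) mpoly)"
  obtain M :: "'k mat" where M: "M \<in> carrier_mat n n"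
    "\<And>i j. i < n \<Longrightarrow> 1 \<le> j \<Longrightarrow> j \<le> n \<Longrightarrow> JM n M i j = 1"
    by (rule exists_JM[of n "\<lambda>_ _. 1"]) auto
  have "mp_eval (\<lambda>c. c) (pt M) (J n (Suc i, j)) = 1"
    using mp_eval_J[OF comm_ring_hom_id ij, of "pt M"] M(2)[OF ij] mat_pt[OF M(1)] by simp
  then show False using \<open>J n (Suc i, j) = 0\<close> mp_eval_0[OF comm_ring_hom_id, of "pt M"] by simp
qed

section \<open>The generic matrix over the function field\<close>

definition generic_rf_mat :: "nat \<Rightarrow> 'k::field ratfun mat" where
  "generic_rf_mat n = map_mat to_fract (generic_mat n)"

lemma generic_rf_mat_carrier [simp]: "generic_rf_mat n \<in> carrier_mat n n"
  by (simp add: generic_rf_mat_def)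

lemma JM_generic_rf_mat:
  assumes ij: "i < n" "1 \<le> j" "j \<le> n"
  shows "JM n (generic_rf_mat n) i j = (to_fract (J n (Suc i, j)) :: 'k::field ratfun)"
    and "JM n (generic_rf_mat n) i j \<noteq> (0 :: 'k::field ratfun)"
proof -
  interpret comm_ring_hom "to_fract :: (nat \<times> nat, 'k) mpoly \<Rightarrow> _" by (rule comm_ring_hom_to_fract)
  show 1: "JM n (generic_rf_mat n) i j = (to_fract (J n (Suc i, j)) :: 'k ratfun)"
    using hom_JM[of "generic_mat n" n i j] ij by (simp add: generic_rf_mat_def J_eq_JM)
  show "JM n (generic_rf_mat n) i j \<noteq> (0 :: 'k ratfun)"
    unfolding 1 using J_nonzero[OF ij, where 'k = 'k] by simp
qed

lemma det_generic_rf_mat: "det (generic_rf_mat n :: 'k::field ratfun mat) \<noteq> 0"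
proof (cases "n = 0")
  case False
  let ?X = "generic_rf_mat n :: 'k ratfun mat"
  \<comment> \<open>The determinant is the generator with index \<open>(1, n)\<close>.\<close>
  have "det ?X = JM n ?X 0 n"
    unfolding JM_def minor0_def fdet_mat[OF generic_rf_mat_carrier, symmetric]
    by (simp, rule fdet_cong) auto
  then show ?thesis using JM_generic_rf_mat(2)[of 0 n n, where 'k = 'k] False by simp
qed (metis det_dim_zero generic_rf_mat_carrier zero_neq_one)

lemma mp_eval_generic_rf_mat:
  assumes "mp_vars p \<subseteq> {1..n} \<times> {1..n}"
  shows "mp_eval rf_const (pt (generic_rf_mat n)) p = to_fract p"
proof -
  have "mp_eval rf_const (pt (generic_rf_mat n)) p = mp_eval rf_const (\<lambda>v. to_fract (mp_var v)) p"
    by (rule mp_eval_cong) (use assms in \<open>force simp: pt_def entry_def generic_rf_mat_def generic_mat_def\<close>)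
  also have "\<dots> = to_fract (mp_eval mp_const mp_var p)"
    by (simp add: mp_eval_comp[OF comm_ring_hom_to_fract] rf_const_def[abs_def])
  finally show ?thesis by (simp add: mp_eval_id)
qed

lemma rf_const_inj: "inj (rf_const :: 'k::field \<Rightarrow> 'k ratfun)"
proof (rule injI)
  fix c d :: 'k assume "rf_const c = rf_const d"
  then have "mp_const c = (mp_const d :: (nat \<times> nat, 'k) mpoly)" by (simp add: rf_const_def)
  then have "Poly_Mapping.lookup (mp_const c :: (nat \<times> nat, 'k) mpoly) 0 = Poly_Mapping.lookup (mp_const d :: (nat \<times> nat, 'k) mpoly) 0"
    by simp
  then show "c = d" by (simp add: mp_const_def)
qed

lemma adj_mat_uni_unique:
  fixes g h :: "'a::comm_ring_1 mat"
  assumes g: "uni (<) n g" and h: "h \<in> carrier_mat n n" "h * g = 1\<^sub>m n"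
  shows "adj_mat g = h"
proof -
  note adj = uni_adj[OF g]
  have "h = h * (g * adj_mat g)" using adj h by simp
  also have "\<dots> = h * g * adj_mat g" using adj(1) h(1) uniD(1)[OF g] by simp
  finally show ?thesis using h adj by simp
qed

text \<open>\<open>\<beta> i\<close> is the number of the segment containing \<open>i + 1\<close>.\<close>

locale block_map =
  fixes n :: nat and \<beta> :: "nat \<Rightarrow> nat"
  assumes mono: "i \<le> j \<Longrightarrow> j < n \<Longrightarrow> \<beta> i \<le> \<beta> j"
begin

abbreviation R :: "nat \<Rightarrow> nat \<Rightarrow> bool" where "R i j \<equiv> \<beta> i < \<beta> j"

lemma R_less: "i < n \<Longrightarrow> R i j \<Longrightarrow> i < j"
  using mono[of j i] by (cases "i < j") auto

lemma uni_R_less: "uni R n g \<Longrightarrow> uni (<) n g"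
  by (erule uni_mono) (rule R_less)

lemma uni_R_adj: "uni R n g \<Longrightarrow> uni R n (adj_mat g)"
  by (rule uni_inverse[of n R g]) (use R_less uni_adj[OF uni_R_less] in auto)

text \<open>With \<open>T\<close> the generic element of the group, one variable per free position,
  the value of \<open>r\<close> at the conjugate of \<open>M\<close> is a polynomial
  \<open>\<rho>\<close> over the function field. It vanishes at all points over the infinite field
  \<open>K\<close>, so it is zero. This is the density of \<open>U(K)\<close> in
  \<open>U(F)\<close>.\<close>

lemma uni_R_density:
  fixes M :: "'k::field_char_0 ratfun mat" and r :: "(nat \<times> nat, 'k ratfun) mpoly"
  assumes M: "M \<in> carrier_mat n n" and r: "mp_vars r \<subseteq> {1..n} \<times> {1..n}"
    and zero: "\<And>g :: 'k mat. uni R n g \<Longrightarrow>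
      mp_eval (\<lambda>c. c) (pt (adj_mat (map_mat rf_const g) * M * map_mat rf_const g)) r = 0"
    and u: "uni R n u"
  shows "mp_eval (\<lambda>c. c) (pt (adj_mat u * M * u)) r = 0"
proof -
  interpret c: comm_ring_hom "mp_const :: 'k ratfun \<Rightarrow> (nat \<times> nat, 'k ratfun) mpoly"
    by (rule comm_ring_hom_mp_const)
  define T :: "(nat \<times> nat, 'k ratfun) mpoly mat" where
    "T = mat n n (\<lambda>(i, k). if i = k then 1 else if R i k then mp_var (i, k) else 0)"
  have T: "T \<in> carrier_mat n n" by (simp add: T_def)
  note adjT = adj_mat(1)[OF T]
  define N where "N = adj_mat T * map_mat mp_const M * T"
  have N: "N \<in> carrier_mat n n" using M T adjT by (simp add: N_def)
  define \<rho> where "\<rho> = mp_eval mp_const (pt N) r"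
  have eval: "mp_eval (\<lambda>c. c) t \<rho> = mp_eval (\<lambda>c. c) (pt (adj_mat w * M * w)) r"
    if w: "uni R n w" and t: "\<And>i k. i < n \<Longrightarrow> k < n \<Longrightarrow> R i k \<Longrightarrow> t (i, k) = w $$ (i, k)" for t w
  proof -
    let ?e = "mp_eval (\<lambda>c. c) t"
    interpret e: comm_ring_hom ?e by (rule comm_ring_hom_mp_eval[OF comm_ring_hom_id])
    have ec: "?e (mp_const c) = c" for c by (rule mp_eval_const[OF comm_ring_hom_id])
    have eT: "map_mat ?e T = w"
      by (rule eq_matI)
        (use uniD[OF w] t in \<open>auto simp: T_def mp_eval_var[OF comm_ring_hom_id]\<close>)
    have eM: "map_mat ?e (map_mat mp_const M) = M"
      by (rule eq_matI) (auto simp: ec)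
    have eN: "map_mat ?e N = adj_mat w * M * w"
      unfolding N_def
      using e.mat_hom_mult[of "adj_mat T * map_mat mp_const M" n n T n]
        e.mat_hom_mult[of "adj_mat T" n n "map_mat mp_const M" n] M T adjT
      by (simp add: eT eM e.hom_adj_mat[OF T])
    have "?e \<rho> = mp_eval (\<lambda>c. c) (\<lambda>v. ?e (pt N v)) r"
      unfolding \<rho>_def by (subst mp_eval_comp[OF e.comm_ring_hom_axioms]) (simp add: ec)
    also have "\<dots> = mp_eval (\<lambda>c. c) (pt (map_mat ?e N)) r"
      by (rule mp_eval_cong) (use pt_map_mat[OF N, of _ ?e] r in auto)
    finally show ?thesis by (simp only: eN)
  qed
  have "\<rho> = 0"
  proof (rule ccontr)
    assume "\<rho> \<noteq> 0"
    moreover have "infinite (range (rf_const :: 'k \<Rightarrow> 'k ratfun))"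
      using finite_imageD[of rf_const "UNIV :: 'k set"] rf_const_inj infinite_UNIV_char_0 by blast
    ultimately obtain t where t: "range t \<subseteq> range rf_const" "mp_eval (\<lambda>c. c) t \<rho> \<noteq> 0"
      using mp_eval_nonzero_point by blast
    have "\<forall>v. \<exists>c. t v = rf_const c" using t(1) by (auto simp: image_subset_iff)
    then obtain s where s: "\<And>v. t v = rf_const (s v)" by metis
    define g where "g = mat n n (\<lambda>(i, k). if i = k then 1 else if R i k then s (i, k) else 0)"
    interpret rc: comm_ring_hom "rf_const :: 'k \<Rightarrow> 'k ratfun" by (rule comm_ring_hom_rf_const)
    have g: "uni R n g" "uni R n (map_mat rf_const g)" by (auto simp: uni_def g_def)
    have "mp_eval (\<lambda>c. c) t \<rho> = 0"
      unfolding zero[OF g(1), symmetric] by (rule eval[OF g(2)]) (auto simp: g_def s)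
    with t(2) show False by simp
  qed
  moreover have "mp_eval (\<lambda>c. c) (\<lambda>(i, k). u $$ (i, k)) \<rho> = mp_eval (\<lambda>c. c) (pt (adj_mat u * M * u)) r"
    by (rule eval[OF u]) simp
  ultimately show ?thesis by (simp add: mp_eval_0[OF comm_ring_hom_id])
qed

text \<open>The inverse of the block diagonal part \<open>b\<close> is again block diagonal. Hence
  \<open>a * adj_mat b\<close> agrees with \<open>b * adj_mat b\<close> inside the diagonal blocks
  and vanishes below them.\<close>

lemma uni_block_split:
  fixes a :: "'a::comm_ring_1 mat"
  assumes a: "uni (<) n a"
  defines "b \<equiv> mat n n (\<lambda>(i, k). if \<beta> i = \<beta> k then a $$ (i, k) else 0)"
  shows "uni (<) n b" "uni R n (a * adj_mat b)"
proof -
  let ?S = "\<lambda>i k. i < k \<and> \<beta> i = \<beta> k"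
  have bS: "uni ?S n b" using uniD[OF a] by (auto simp: uni_def b_def)
  then show b: "uni (<) n b" by (rule uni_mono) simp
  note adj = uni_adj[OF b]
  have dS: "uni ?S n (adj_mat b)" by (rule uni_inverse[of n ?S b]) (use bS adj in auto)
  have *: "(a * adj_mat b) $$ (i, k) = (if i = k then 1 else 0)" if ik: "i < n" "k < n" "\<not> R i k" for i k
  proof -
    have sum: "(c * adj_mat b) $$ (i, k) = (\<Sum>q<n. c $$ (i, q) * adj_mat b $$ (q, k))"
      if "c \<in> carrier_mat n n" for c
      by (rule index_mult_sum) (use that adj(1) ik in auto)
    have zero: "adj_mat b $$ (q, k) = 0" if "q < n" "\<beta> q \<noteq> \<beta> k" for q
      using uniD(3)[OF dS, of q k] that ik by auto
    show ?thesis
    proof (cases "\<beta> i = \<beta> k")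
      case True
      have "(a * adj_mat b) $$ (i, k) = (b * adj_mat b) $$ (i, k)"
        unfolding sum[OF uniD(1)[OF a]] sum[OF uniD(1)[OF b]]
      proof (rule sum.cong[OF refl])
        fix q assume "q \<in> {..<n}"
        then show "a $$ (i, q) * adj_mat b $$ (q, k) = b $$ (i, q) * adj_mat b $$ (q, k)"
          using zero[of q] True ik by (cases "\<beta> q = \<beta> k") (auto simp: b_def)
      qed
      then show ?thesis using adj(2) ik by simp
    next
      case False
      have "a $$ (i, q) * adj_mat b $$ (q, k) = 0" if q: "q < n" for q
      proof (cases "\<beta> q = \<beta> k")
        case True
        then have "q < i" using R_less[of q i] False ik q by simp
        then show ?thesis using uniD(3)[OF a, of i q] q ik by simp
      qed (simp add: zero q)
      then have "(a * adj_mat b) $$ (i, k) = 0"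
        unfolding sum[OF uniD(1)[OF a]] by (intro sum.neutral) simp
      then show ?thesis using False by auto
    qed
  qed
  show "uni R n (a * adj_mat b)"
    unfolding uni_def using * uniD(1)[OF a] adj(1) by (simp del: index_mult_mat(1))
qed

end

section \<open>The field of invariants\<close>

lemma anti_lower_mult_uni:
  assumes B: "anti_lower n B" and a: "uni (<) n a"
  shows "anti_lower n (B * a)"
proof -
  note car = anti_lowerD(1)[OF B] uniD(1)[OF a]
  have "(B * a) $$ (i, c) = 0" if "i + c < n - 1" for i c
  proof -
    have "(B * a) $$ (i, c) = (\<Sum>q<n. B $$ (i, q) * a $$ (q, c))"
      by (rule index_mult_sum[OF car]) (use that in auto)
    also have "\<dots> = 0"
    proof (intro sum.neutral ballI)
      fix q assume "q \<in> {..<n}"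
      then show "B $$ (i, q) * a $$ (q, c) = 0"
        using anti_lowerD(2)[OF B, of i q] uniD(3)[OF a, of q c] that by (cases "q \<le> c") auto
    qed
    finally show ?thesis .
  qed
  then show ?thesis using car by (simp add: anti_lower_def del: index_mult_mat(1))
qed

lemma mult_inverse_cancel:
  fixes A B C :: "'a::comm_ring_1 mat"
  assumes "A \<in> carrier_mat n n" "B \<in> carrier_mat n n" "C \<in> carrier_mat n n" "A * B = 1\<^sub>m n"
  shows "A * (B * C) = C"
  using assms by (simp flip: assoc_mult_mat[of A n n B n C n])

lemma uni_map_rf_const: "uni R n g \<Longrightarrow> uni R n (map_mat rf_const g)"
proof -
  interpret comm_ring_hom rf_const by (rule comm_ring_hom_rf_const)
  show "uni R n g \<Longrightarrow> uni R n (map_mat rf_const g)" by (auto simp: uni_def)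
qed

section \<open>Arithmetic in \<open>GL_field n\<close> and the conjugation action\<close>

lemma GL_fieldE:
  assumes "f \<in> GL_field n"
  obtains p q where "f = Fract p q" "mp_vars p \<subseteq> {1..n} \<times> {1..n}" "mp_vars q \<subseteq> {1..n} \<times> {1..n}" "q \<noteq> 0"
  using assms unfolding GL_field_eq by blast

lemma GL_fieldI:
  "mp_vars p \<subseteq> {1..n} \<times> {1..n} \<Longrightarrow> mp_vars q \<subseteq> {1..n} \<times> {1..n} \<Longrightarrow> q \<noteq> 0 \<Longrightarrow> Fract p q \<in> GL_field n"
  unfolding GL_field_eq by blast

lemma conj_act_field_hom:
  fixes g :: "'k::field mat"
  assumes g: "g \<in> carrier_mat n n" "invertible_mat g"
    and x: "x \<in> GL_field n" and y: "y \<in> GL_field n"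
  shows "x + y \<in> GL_field n" "conj_act n g (x + y) = conj_act n g x + conj_act n g y"
    and "x * y \<in> GL_field n" "conj_act n g (x * y) = conj_act n g x * conj_act n g y"
    and "- x \<in> GL_field n" "conj_act n g (- x) = - conj_act n g x"
    and "inverse x \<in> GL_field n" "conj_act n g (inverse x) = inverse (conj_act n g x)"
proof -
  let ?V = "{1..n} \<times> {1..n}" and ?e = "mp_eval rf_const (conj_point n g)"
  interpret e: comm_ring_hom ?e by (rule comm_ring_hom_mp_eval[OF comm_ring_hom_rf_const])
  note act = conj_act_Fract[OF g]
  obtain p q where pq: "x = Fract p q" "mp_vars p \<subseteq> ?V" "mp_vars q \<subseteq> ?V" "q \<noteq> 0"
    using x by (rule GL_fieldE)
  obtain r s where rs: "y = Fract r s" "mp_vars r \<subseteq> ?V" "mp_vars s \<subseteq> ?V" "s \<noteq> 0"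
    using y by (rule GL_fieldE)
  have vm: "mp_vars (u * v) \<subseteq> ?V" if "mp_vars u \<subseteq> ?V" "mp_vars v \<subseteq> ?V" for u v :: "(nat \<times> nat, 'k) mpoly"
    using that by (intro order_trans[OF mp_vars_mult] Un_least)
  have va: "mp_vars (u + v) \<subseteq> ?V" if "mp_vars u \<subseteq> ?V" "mp_vars v \<subseteq> ?V" for u v :: "(nat \<times> nat, 'k) mpoly"
    using that by (intro order_trans[OF mp_vars_add] Un_least)
  have qs: "mp_vars (q * s) \<subseteq> ?V" "q * s \<noteq> 0" using vm[OF pq(3) rs(3)] pq(4) rs(4) by simp_all
  note nz = act(1)[OF pq(3,4)] act(1)[OF rs(3,4)]
  have add: "x + y = Fract (p * s + r * q) (q * s)" using pq rs by simp
  show "x + y \<in> GL_field n" unfolding add by (intro GL_fieldI va vm pq rs qs)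
  show "conj_act n g (x + y) = conj_act n g x + conj_act n g y"
    unfolding add act(2)[OF qs] unfolding pq(1) rs(1) act(2)[OF pq(3,4)] act(2)[OF rs(3,4)]
    using nz by (simp add: e.hom_add e.hom_mult add_frac_eq)
  have mult: "x * y = Fract (p * r) (q * s)" using pq rs by simp
  show "x * y \<in> GL_field n" unfolding mult by (intro GL_fieldI vm pq rs qs)
  show "conj_act n g (x * y) = conj_act n g x * conj_act n g y"
    unfolding mult act(2)[OF qs] unfolding pq(1) rs(1) act(2)[OF pq(3,4)] act(2)[OF rs(3,4)]
    by (simp add: e.hom_mult)
  have minus: "- x = Fract (- p) q" using pq by simp
  have vp: "mp_vars (- p) \<subseteq> ?V" using pq(2) by (simp add: mp_vars_def)
  show "- x \<in> GL_field n" unfolding minus by (intro GL_fieldI vp pq)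
  show "conj_act n g (- x) = - conj_act n g x"
    unfolding minus act(2)[OF pq(3,4)] unfolding pq(1) act(2)[OF pq(3,4)]
    by (simp add: e.hom_uminus)
  \<comment> \<open>For \<open>p = 0\<close> the inverse is 0 by convention, and
    \<open>Fract q p\<close> has no valid denominator.\<close>
  show "inverse x \<in> GL_field n"
  proof (cases "p = 0")
    case True
    then have "inverse x = x" using pq by (simp add: fract_collapse)
    then show ?thesis using x by simp
  next
    case False
    have "inverse x = Fract q p" using pq by simp
    then show ?thesis using GL_fieldI[OF pq(3,2) False] by simp
  qed
  show "conj_act n g (inverse x) = inverse (conj_act n g x)"
  proof (cases "p = 0")
    case True
    then have "inverse x = x" using pq by (simp add: fract_collapse)
    moreover have "conj_act n g x = 0"
      unfolding pq(1) act(2)[OF pq(3,4)] True by simp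
    ultimately show ?thesis by simp
  next
    case False
    have inv: "inverse x = Fract q p" using pq by simp
    show ?thesis unfolding inv act(2)[OF pq(2) False] unfolding pq(1) act(2)[OF pq(3,4)] by simp
  qed
qed

lemma conj_act_to_fract:
  assumes g: "g \<in> carrier_mat n n" "invertible_mat g"
  shows "conj_act n g (to_fract p) = mp_eval rf_const (conj_point n g) p"
proof -
  have "conj_act n g (Fract p 1) = mp_eval rf_const (conj_point n g) p / mp_eval rf_const (conj_point n g) 1"
    by (rule conj_act_Fract(2)[OF g]) auto
  then show ?thesis by (simp add: mp_eval_1[OF comm_ring_hom_rf_const] Fract_conv_to_fract)
qed

lemma to_fract_GL_field: "mp_vars p \<subseteq> {1..n} \<times> {1..n} \<Longrightarrow> to_fract p \<in> GL_field n"
  using GL_fieldI[of p n 1] by (simp add: Fract_conv_to_fract)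

text \<open>In terms of \<open>\<beta>\<close> the group \<open>U\<close> becomes
  \<open>uni R n\<close>, and the index set an inequality between segment numbers. The equivalence
  is restricted to \<open>{1..l}\<close> because \<open>I\<close> is arbitrary outside.\<close>

locale segment_blocks = block_map +
  fixes l :: nat and I :: "nat \<Rightarrow> nat set"
  assumes I: "segment_partition n l I"
    and block: "i < n \<Longrightarrow> k \<in> {1..l} \<Longrightarrow> Suc i \<in> I k \<longleftrightarrow> k = \<beta> i"
    and block_range: "i < n \<Longrightarrow> \<beta> i \<in> {1..l}"
begin

lemma unipotent_radical_eq: "unipotent_radical n l I = {g. uni R n g}"
proof (intro subset_antisym subsetI)
  fix g :: "'k::field mat" assume "g \<in> unipotent_radical n l I"
  then obtain A where A: "g = 1\<^sub>m n + A" "A \<in> carrier_mat n n"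
    and nz: "\<And>i j. i \<in> {1..n} \<Longrightarrow> j \<in> {1..n} \<Longrightarrow> entry A i j \<noteq> 0 \<Longrightarrow>
      \<exists>k\<in>{1..l}. \<exists>m\<in>{1..l}. k < m \<and> i \<in> I k \<and> j \<in> I m"
    unfolding unipotent_radical_def by blast
  have A0: "A $$ (i, j) = 0" if "i < n" "j < n" "\<not> R i j" for i j
  proof (rule ccontr)
    assume "A $$ (i, j) \<noteq> 0"
    then have "\<exists>k\<in>{1..l}. \<exists>m\<in>{1..l}. k < m \<and> Suc i \<in> I k \<and> Suc j \<in> I m"
      using nz[of "Suc i" "Suc j"] that by (simp add: entry_def)
    then show False using that block by auto
  qed
  then show "g \<in> {g. uni R n g}" using A by (simp add: uni_def)
next
  fix g :: "'k::field mat" assume "g \<in> {g. uni R n g}"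
  then have g: "uni R n g" by simp
  define A where "A = g - 1\<^sub>m n"
  have "g = 1\<^sub>m n + A" unfolding A_def by (rule eq_matI) (use uniD(1)[OF g] in auto)
  moreover have "A \<in> carrier_mat n n" unfolding A_def by (rule minus_carrier_mat) simp
  moreover have "\<exists>k\<in>{1..l}. \<exists>m\<in>{1..l}. k < m \<and> i \<in> I k \<and> j \<in> I m"
    if ij: "i \<in> {1..n}" "j \<in> {1..n}" "entry A i j \<noteq> 0" for i j
  proof -
    have ij': "i - 1 < n" "j - 1 < n" "Suc (i - 1) = i" "Suc (j - 1) = j" using ij by auto
    have "R (i - 1) (j - 1)"
    proof (rule ccontr)
      assume "\<not> R (i - 1) (j - 1)"
      then have "g $$ (i - 1, j - 1) = (1\<^sub>m n) $$ (i - 1, j - 1)"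
        using uniD(2)[OF g ij'(1)] uniD(3)[OF g ij'(1,2)] ij'(1,2)
        by (cases "i - 1 = j - 1") auto
      then show False using ij(3) ij'(1,2) uniD(1)[OF g] by (simp add: entry_def A_def)
    qed
    moreover have "i \<in> I (\<beta> (i - 1))" "j \<in> I (\<beta> (j - 1))"
      using block[OF ij'(1) block_range[OF ij'(1)]] block[OF ij'(2) block_range[OF ij'(2)]] ij'(3,4) by simp_all
    ultimately show ?thesis
      using block_range[OF ij'(1)] block_range[OF ij'(2)] by (intro bexI conjI)
  qed
  ultimately show "g \<in> unipotent_radical n l I" unfolding unipotent_radical_def by blast
qed

lemma index_set_iff:
  "(i, j) \<in> index_set n l I \<longleftrightarrow> i \<in> {1..n} \<and> j \<in> {1..n} \<and> \<beta> (n - j) \<le> \<beta> (i - 1)"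
proof -
  have "(\<exists>k\<in>{1..l}. \<exists>m\<in>{1..l}. i \<in> I k \<and> j \<in> opp n ` I m \<and> k \<ge> m) \<longleftrightarrow> \<beta> (n - j) \<le> \<beta> (i - 1)"
    if ij: "i \<in> {1..n}" "j \<in> {1..n}"
  proof -
    have i: "i - 1 < n" "Suc (i - 1) = i" and j: "n - j < n" "Suc (n - j) = opp n j" using ij by (auto simp: opp_def)
    \<comment> \<open>\<open>opp n\<close> is an involution on \<open>{1..n}\<close>, but truncated
      subtraction breaks this for large numbers, so \<open>I m\<close> is first placed inside
      \<open>{1..n}\<close>.\<close>
    have opp: "j \<in> opp n ` I m \<longleftrightarrow> Suc (n - j) \<in> I m" if m: "m \<in> {1..l}" for m
    proof -
      have "I m \<subseteq> {1..n}" using I m unfolding segment_partition_def by blast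
      then have "x = Suc (n - j)" if "x \<in> I m" "j = opp n x" for x
        using that ij by (auto simp: opp_def)
      moreover have "j = opp n (Suc (n - j))" using ij by (auto simp: opp_def)
      ultimately show ?thesis by (auto intro!: image_eqI)
    qed
    have "(\<exists>k\<in>{1..l}. \<exists>m\<in>{1..l}. i \<in> I k \<and> j \<in> opp n ` I m \<and> k \<ge> m) \<longleftrightarrow>
        (\<exists>k\<in>{1..l}. \<exists>m\<in>{1..l}. k = \<beta> (i - 1) \<and> m = \<beta> (n - j) \<and> k \<ge> m)"
      using block[OF i(1)] block[OF j(1)] opp unfolding i(2) by (intro bex_cong refl) simp
    then show ?thesis
      using block_range[OF i(1)] block_range[OF j(1)] by auto
  qed
  then show ?thesis by (auto simp: index_set_def)
qed

lemma index_setE: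
  assumes "s \<in> index_set n l I"
  obtains i j where "s = (Suc i, j)" "i < n" "1 \<le> j" "j \<le> n" "\<beta> (n - j) \<le> \<beta> i"
proof -
  obtain i j where s: "s = (i, j)" by (cases s)
  then have "s = (Suc (i - 1), j)" "i - 1 < n" "1 \<le> j" "j \<le> n" "\<beta> (n - j) \<le> \<beta> (i - 1)"
    using assms by (auto simp: index_set_iff)
  then show ?thesis by (rule that)
qed

lemma index_setI: "i < n \<Longrightarrow> 1 \<le> j \<Longrightarrow> j \<le> n \<Longrightarrow> \<beta> (n - j) \<le> \<beta> i \<Longrightarrow> (Suc i, j) \<in> index_set n l I"
  by (simp add: index_set_iff)

text \<open>Puts the conjugate into the form with adjugates to which the density lemma
  applies.\<close>

lemma conj_point_uni:
  fixes g :: "'k::field mat"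
  assumes g: "uni R n g"
  shows "conj_point n g = pt (adj_mat (map_mat rf_const g) * generic_rf_mat n * map_mat rf_const g)"
proof -
  interpret comm_ring_hom "rf_const :: 'k \<Rightarrow> _" by (rule comm_ring_hom_rf_const)
  have "g \<in> unipotent_radical n l I" using g by (simp add: unipotent_radical_eq)
  note props = mat_inverse_props[OF unipotent_radical_invertible[OF I this]]
  have "the (mat_inverse g) = adj_mat g"
    by (rule adj_mat_uni_unique[OF uni_R_less[OF g] props(1,3), symmetric])
  then show ?thesis
    by (simp add: conj_point_def pt_def generic_rf_mat_def hom_adj_mat[OF uniD(1)[OF g]])
qed

lemma J_invariant:
  assumes s: "s \<in> index_set n l I"
  shows "to_fract (J n s) \<in> (invariant_field n l I :: 'k::field ratfun set)"
proof -
  obtain i j where s: "s = (Suc i, j)" and ij: "i < n" "1 \<le> j" "j \<le> n" and \<beta>: "\<beta> (n - j) \<le> \<beta> i"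
    using s by (rule index_setE)
  have "conj_act n g (to_fract (J n s)) = (to_fract (J n s) :: 'k ratfun)"
    if "g \<in> unipotent_radical n l I" for g :: "'k mat"
  proof -
    let ?G = "map_mat rf_const g" and ?X = "generic_rf_mat n :: 'k ratfun mat"
    have g: "uni R n g" using that by (simp add: unipotent_radical_eq)
    have G: "uni R n ?G" by (rule uni_map_rf_const[OF g])
    note adj = uni_adj[OF uni_R_less[OF G]]
    have car: "adj_mat ?G * ?X * ?G \<in> carrier_mat n n"
      using adj(1) uniD(1)[OF G] by (intro mult_carrier_mat[of _ n n]) auto
    have "conj_act n g (to_fract (J n s)) = JM n (adj_mat ?G * ?X * ?G) i j"
      using conj_act_to_fract[OF unipotent_radical_invertible[OF I that], of "J n s"]
        mp_eval_J[OF comm_ring_hom_rf_const ij, of "pt (adj_mat ?G * ?X * ?G)"]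
      by (simp only: conj_point_uni[OF g] s mat_pt[OF car])
    also have "\<dots> = JM n ?X i j"
    proof (rule JM_conj[OF uni_R_less[OF uni_R_adj[OF G]] uni_R_less[OF G] adj(3,2)])
      \<comment> \<open>For a pair of the index set the rows \<open>i\<close> to
        \<open>n - j\<close> lie in one segment, so \<open>U\<close> allows no off-diagonal entry of
        row \<open>i\<close> there.\<close>
      fix q assume "i + j \<le> n" "i < q" "q \<le> n - j" "q < n"
      then have "\<beta> q \<le> \<beta> i" using mono[of q "n - j"] \<beta> ij by simp
      then show "adj_mat ?G $$ (i, q) = 0"
        using uniD(3)[OF uni_R_adj[OF G], of i q] ij \<open>i < q\<close> \<open>q < n\<close> by simp
    qed (use det_generic_rf_mat ij in auto)
    finally show ?thesis using JM_generic_rf_mat(1)[OF ij] s by simp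
  qed
  moreover have "to_fract (J n s) \<in> (GL_field n :: 'k ratfun set)"
    unfolding s by (rule to_fract_GL_field[OF mp_vars_J[OF ij]])
  ultimately show ?thesis by (simp add: invariant_field_def)
qed

lemma invariant_subfield: "is_subfield (invariant_field n l I :: 'k::field ratfun set)"
  and rf_const_invariant: "rf_const c \<in> (invariant_field n l I :: 'k::field ratfun set)"
proof -
  have const: "rf_const c \<in> (invariant_field n l I :: 'k ratfun set)" for c
    using conj_act_to_fract[OF unipotent_radical_invertible[OF I], of _ "mp_const c"]
    by (simp add: invariant_field_def rf_const_def to_fract_GL_field mp_eval_const[OF comm_ring_hom_rf_const])
  then show "rf_const c \<in> (invariant_field n l I :: 'k ratfun set)" .
  interpret comm_ring_hom "rf_const :: 'k \<Rightarrow> _" by (rule comm_ring_hom_rf_const)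
  have 1: "1\<^sub>m n \<in> (unipotent_radical n l I :: 'k mat set)"
    by (simp add: unipotent_radical_eq uni_def)
  note hom = conj_act_field_hom[OF unipotent_radical_invertible[OF I]]
  show "is_subfield (invariant_field n l I :: 'k ratfun set)"
    unfolding is_subfield_def
  proof (intro conjI ballI)
    show "0 \<in> (invariant_field n l I :: 'k ratfun set)" "1 \<in> (invariant_field n l I :: 'k ratfun set)"
      using const[of 0] const[of 1] by simp_all
  next
    fix x y :: "'k ratfun" assume "x \<in> invariant_field n l I" "y \<in> invariant_field n l I"
    then have x: "x \<in> GL_field n" "\<And>g. g \<in> unipotent_radical n l I \<Longrightarrow> conj_act n g x = x"
      and y: "y \<in> GL_field n" "\<And>g. g \<in> unipotent_radical n l I \<Longrightarrow> conj_act n g y = y"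
      by (auto simp: invariant_field_def)
    show "x + y \<in> invariant_field n l I" "x * y \<in> invariant_field n l I"
      using hom(1,3)[OF 1 1 x(1) y(1)] hom(2,4)[OF _ _ x(1) y(1)] x(2) y(2)
      by (simp_all add: invariant_field_def)
  next
    fix x :: "'k ratfun" assume "x \<in> invariant_field n l I"
    then have x: "x \<in> GL_field n" "\<And>g. g \<in> unipotent_radical n l I \<Longrightarrow> conj_act n g x = x"
      by (auto simp: invariant_field_def)
    show "- x \<in> invariant_field n l I" "inverse x \<in> invariant_field n l I"
      using hom(5,7)[OF 1 1 x(1) x(1)] hom(6,8)[OF _ _ x(1) x(1)] x(2)
      by (simp_all add: invariant_field_def)
  qed
qed

end

lemma ex_segment_blocks:
  assumes I: "segment_partition n l I"
  shows "\<exists>\<beta>. segment_blocks n \<beta> l I"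
proof -
  have disj: "i < j" if "k \<in> {1..l}" "m \<in> {1..l}" "k < m" "i \<in> I k" "j \<in> I m" for k m i j
    using I that unfolding segment_partition_def by blast
  have "\<forall>i. \<exists>k. i < n \<longrightarrow> k \<in> {1..l} \<and> Suc i \<in> I k"
  proof
    fix i
    have "i < n \<Longrightarrow> Suc i \<in> (\<Union>k\<in>{1..l}. I k)" using I unfolding segment_partition_def by simp
    then show "\<exists>k. i < n \<longrightarrow> k \<in> {1..l} \<and> Suc i \<in> I k" by blast
  qed
  then obtain \<beta> where \<beta>: "\<And>i. i < n \<Longrightarrow> \<beta> i \<in> {1..l}" "\<And>i. i < n \<Longrightarrow> Suc i \<in> I (\<beta> i)"
    by metis
  have "segment_blocks n \<beta> l I"
  proof
    fix i j assume "i \<le> j" "j < n"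
    then show "\<beta> i \<le> \<beta> j"
      using disj[of "\<beta> j" "\<beta> i" "Suc j" "Suc i"] \<beta>[of i] \<beta>[of j] by (cases "\<beta> i \<le> \<beta> j") auto
  next
    fix i k assume "i < n" "k \<in> {1..l}"
    then show "Suc i \<in> I k \<longleftrightarrow> k = \<beta> i"
      using disj[of k "\<beta> i" "Suc i" "Suc i"] disj[of "\<beta> i" k "Suc i" "Suc i"] \<beta>[of i]
      by (cases k "\<beta> i" rule: linorder_cases) auto
  qed (use I \<beta> in auto)
  then show ?thesis by blast
qed

section \<open>Generation and algebraic independence\<close>

lemma conj_conj_cancel:
  fixes A B X :: "'a::comm_ring_1 mat"
  assumes "A \<in> carrier_mat n n" "B \<in> carrier_mat n n" "X \<in> carrier_mat n n" "A * B = 1\<^sub>m n"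
  shows "A * (B * X * A) * B = X"
  using assms by (simp add: assoc_mult_mat[of _ n n _ n _ n] mult_inverse_cancel[OF assms(1,2) _ assms(4)])

context segment_blocks
begin

text \<open>From \<open>X = a * Y * h\<close> one takes \<open>u = a * adj_mat b\<close> and
  \<open>Z = b * Y * adj_mat b\<close>. The entries of \<open>Y\<close> come from the triangular
  system, and those of \<open>b\<close> that are not 0 or 1 by definition are quotients of
  generators.\<close>

lemma generic_conj_into_subfield:
  fixes L :: "'k::field ratfun set"
  assumes L: "is_subfield L" and J: "\<And>s. s \<in> index_set n l I \<Longrightarrow> to_fract (J n s) \<in> L"
  obtains u Z where "uni R n u" "Z \<in> carrier_mat n n" "\<And>i k. i < n \<Longrightarrow> k < n \<Longrightarrow> Z $$ (i, k) \<in> L"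
    "generic_rf_mat n = u * Z * adj_mat u"
proof -
  let ?X = "generic_rf_mat n :: 'k ratfun mat"
  have JL: "JM n ?X i j \<in> L" if "i < n" "1 \<le> j" "j \<le> n" "\<beta> (n - j) \<le> \<beta> i" for i j
    using J[OF index_setI[OF that]] JM_generic_rf_mat(1)[OF that(1-3), where 'k = 'k] by simp
  obtain h where h: "uni (<) n h" "anti_lower n (h * ?X)"
  proof (rule gauss_anti_lower[of ?X n])
    show "JM n ?X (n - j) j \<noteq> 0" if "1 \<le> j" "j \<le> n" for j
      by (rule JM_generic_rf_mat(2)) (use that in auto)
  qed auto
  note ch = uniD(1)[OF h(1)]
  define a where "a = adj_mat h"
  have ca: "a \<in> carrier_mat n n" and ha: "h * a = 1\<^sub>m n" "a * h = 1\<^sub>m n"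
    using uni_adj[OF h(1)] by (simp_all add: a_def)
  have a: "uni (<) n a" by (rule uni_inverse[of n "(<)" h]) (use h(1) ca ha in auto)
  define Y where "Y = h * ?X * a"
  have Y: "anti_lower n Y" unfolding Y_def by (rule anti_lower_mult_uni[OF h(2) a])
  note cY = anti_lowerD(1)[OF Y]
  note assoc = assoc_mult_mat[of _ n n _ n _ n]
  have X: "a * Y * h = ?X"
    unfolding Y_def by (rule conj_conj_cancel[OF ca ch generic_rf_mat_carrier ha(2)])
  have detY: "det Y \<noteq> 0"
    unfolding Y_def using det_conj[OF ca ch generic_rf_mat_carrier ha(1)] det_generic_rf_mat by simp
  note JY = JM_uni_conj_anti_lower[OF a h(1) ha(2,1) Y detY, unfolded X]
  have YL: "Y $$ (p, q) \<in> L" if "p < n" "q < n" for p q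
  proof (rule anti_lower_entries_in_subfield[OF L Y _ that])
    \<comment> \<open>Pairs on or below the anti-diagonal always belong to the index set, since
      \<open>n - j \<le> i\<close> and \<open>\<beta>\<close> is monotone.\<close>
    fix i j assume ij: "i < n" "1 \<le> j" "j \<le> n" "n \<le> i + j"
    then show "JM n Y i j \<in> L \<and> JM n Y i j \<noteq> 0"
      using JY(2)[OF ij] JL[OF ij(1-3)] JM_generic_rf_mat(2)[OF ij(1-3), where 'k = 'k] mono[of "n - j" i]
      by simp
  qed
  define b where "b = mat n n (\<lambda>(i, k). if \<beta> i = \<beta> k then a $$ (i, k) else 0)"
  have b: "uni (<) n b" and u: "uni R n (a * adj_mat b)"
    unfolding b_def by (rule uni_block_split[OF a])+
  note cb = uniD(1)[OF b] and adj = uni_adj[OF b]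
  have bL: "b $$ (i, k) \<in> L" if ik: "i < n" "k < n" for i k
  proof -
    consider "i = k" | "k < i" | "\<beta> i \<noteq> \<beta> k" | "i < k" "\<beta> i = \<beta> k" by linarith
    then show ?thesis
    proof cases
      case 4
      then have j: "1 \<le> n - k" "n - k \<le> n" "i + (n - k) \<le> n" "n - (n - k) = k" using ik by auto
      have "JM n ?X i (n - k) = a $$ (i, k) * JM n Y k (n - k)"
        using JY(1)[OF ik(1) j(1-3)] j(4) by simp
      moreover have "JM n ?X k (n - k) = JM n Y k (n - k)"
        using JY(2)[OF ik(2) j(1,2)] ik by simp
      \<comment> \<open>Both generators belong to the index set because \<open>i\<close> and
        \<open>k\<close> lie in the same segment.\<close>
      ultimately have "a $$ (i, k) = JM n ?X i (n - k) / JM n ?X k (n - k)"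
        using JM_generic_rf_mat(2)[OF ik(2) j(1,2), where 'k = 'k] by simp
      also have "\<dots> \<in> L"
        by (intro subfield_divide[OF L] JL) (use ik j 4 in auto)
      finally show ?thesis using ik 4 by (simp add: b_def)
    qed (use uniD(2,3)[OF b] ik subfield_0[OF L] subfield_1[OF L] in \<open>auto simp: b_def\<close>)
  qed
  define Z where "Z = b * Y * adj_mat b"
  have cZ: "Z \<in> carrier_mat n n" using cb cY adj(1) by (simp add: Z_def)
  have ZL: "Z $$ (i, k) \<in> L" if "i < n" "k < n" for i k
    unfolding Z_def
    by (rule subfield_mult_mat[OF L _ subfield_mult_mat[OF L cb bL cY YL] adj(1) subfield_adj_mat[OF L cb bL] that])
      (use cb cY in auto)
  \<comment> \<open>With this inverse of \<open>u\<close> the factors \<open>b\<close> cancel in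
    \<open>u * Z * adj_mat u\<close>.\<close>
  have "adj_mat (a * adj_mat b) = b * h"
    by (rule adj_mat_uni_unique[OF uni_R_less[OF u]])
      (use ca ch cb adj in \<open>simp_all add: assoc mult_inverse_cancel[OF ch ca _ ha(1)]\<close>)
  then have "a * adj_mat b * Z * adj_mat (a * adj_mat b) = a * Y * h"
    unfolding Z_def using ca ch cb cY adj(1)
    by (simp add: assoc mult_inverse_cancel[OF adj(1) cb _ adj(3)])
  then show ?thesis using that[OF u cZ ZL] X by simp
qed

text \<open>By density an invariant has the value \<open>f\<close> at every
  \<open>U(F)\<close>-conjugate of the generic matrix where the denominator is nonzero. The
  conjugate \<open>M\<close> is such a point with entries in \<open>L\<close>, so the value there
  lies in \<open>L\<close>.\<close>

lemma invariant_field_minimal: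
  fixes L :: "'k::field_char_0 ratfun set"
  assumes L: "is_subfield L" and const: "range rf_const \<subseteq> L"
    and J: "\<And>s. s \<in> index_set n l I \<Longrightarrow> to_fract (J n s) \<in> L"
    and f: "f \<in> invariant_field n l I"
  shows "f \<in> L"
proof -
  let ?X = "generic_rf_mat n :: 'k ratfun mat" and ?V = "{1..n} \<times> {1..n}"
  obtain u Z where u: "uni R n u" and cZ: "Z \<in> carrier_mat n n"
    and ZL: "\<And>i k. i < n \<Longrightarrow> k < n \<Longrightarrow> Z $$ (i, k) \<in> L" and X: "?X = u * Z * adj_mat u"
    using generic_conj_into_subfield[OF L J] by blast
  define w where "w = adj_mat u"
  have w: "uni R n w" unfolding w_def by (rule uni_R_adj[OF u])
  note cu = uniD(1)[OF u] and cw = uniD(1)[OF w]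
  have uw: "u * w = 1\<^sub>m n" "w * u = 1\<^sub>m n" using uni_adj[OF uni_R_less[OF u]] by (simp_all add: w_def)
  have adj_w: "adj_mat w = u" by (rule adj_mat_uni_unique[OF uni_R_less[OF w] cu uw(1)])
  have XZ: "u * Z * w = ?X" by (simp add: X w_def)
  note assoc = assoc_mult_mat[of _ n n _ n _ n]
  obtain p q where pq: "f = Fract p q" "mp_vars p \<subseteq> ?V" "mp_vars q \<subseteq> ?V" "q \<noteq> 0"
    by (rule GL_fieldE[of f n]) (use f in \<open>auto simp: invariant_field_def\<close>)
  \<comment> \<open>Density is stated for polynomials over the function field, so the coefficients
    from \<open>K\<close> are embedded.\<close>
  define lift :: "(nat \<times> nat, 'k) mpoly \<Rightarrow> (nat \<times> nat, 'k ratfun) mpoly" where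
    "lift = mp_eval (\<lambda>c. mp_const (rf_const c)) mp_var"
  have lift_vars: "mp_vars (lift r) \<subseteq> ?V" if "mp_vars r \<subseteq> ?V" for r
  proof -
    have "lift r = mp_eval (\<lambda>c. mp_const (rf_const c)) (\<lambda>v. if v \<in> ?V then mp_var v else 0) r"
      unfolding lift_def by (rule mp_eval_cong) (use that in auto)
    also have "mp_vars \<dots> \<subseteq> ?V" by (rule mp_vars_mp_eval) auto
    finally show ?thesis .
  qed
  have lift_eval: "mp_eval (\<lambda>c. c) t (lift r) = mp_eval rf_const t r" for t r
    unfolding lift_def
    by (simp add: mp_eval_comp[OF comm_ring_hom_mp_eval[OF comm_ring_hom_id]]
        mp_eval_const[OF comm_ring_hom_id] mp_eval_var[OF comm_ring_hom_id])
  have q0: "to_fract q \<noteq> 0" using pq(4) by simp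
  \<comment> \<open>The denominator may vanish at \<open>Z\<close>, but not at every \<open>K\<close>-rational conjugate of \<open>Z\<close>.\<close>
  have "\<exists>g :: 'k mat. uni R n g \<and>
      mp_eval rf_const (pt (adj_mat (map_mat rf_const g) * Z * map_mat rf_const g)) q \<noteq> 0"
  proof (rule ccontr)
    assume "\<nexists>g :: 'k mat. uni R n g \<and>
      mp_eval rf_const (pt (adj_mat (map_mat rf_const g) * Z * map_mat rf_const g)) q \<noteq> 0"
    \<comment> \<open>Conjugating \<open>Z\<close> by \<open>w\<close> gives the generic matrix,
      where the value of \<open>q\<close> is \<open>to_fract q\<close>, which is nonzero.\<close>
    then have "mp_eval (\<lambda>c. c) (pt (adj_mat w * Z * w)) (lift q) = 0"
      by (intro uni_R_density[OF cZ lift_vars[OF pq(3)] _ w]) (auto simp: lift_eval)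
    then show False
      using mp_eval_generic_rf_mat[OF pq(3)] q0 by (simp add: lift_eval adj_w XZ)
  qed
  then obtain g :: "'k mat" where g: "uni R n g"
    and nz: "mp_eval rf_const (pt (adj_mat (map_mat rf_const g) * Z * map_mat rf_const g)) q \<noteq> 0"
    by blast
  define G where "G = map_mat rf_const g"
  have G: "uni R n G" unfolding G_def by (rule uni_map_rf_const[OF g])
  note cG = uniD(1)[OF G] and adjG = uni_adj[OF uni_R_less[OF G]]
  define M where "M = adj_mat G * Z * G"
  have cM: "M \<in> carrier_mat n n" using cZ cG adjG(1) by (simp add: M_def)
  have uG: "uni R n (u * G)" by (rule uni_mult[OF _ _ u G]) (use R_less in auto)
  have "adj_mat (u * G) = adj_mat G * w"
    by (rule adj_mat_uni_unique[OF uni_R_less[OF uG]])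
      (use cu cw cG adjG in \<open>simp_all add: assoc mult_inverse_cancel[OF cw cu _ uw(2)]\<close>)
  then have conj: "adj_mat (u * G) * ?X * (u * G) = M"
    unfolding XZ[symmetric] M_def using cu cw cG cZ adjG(1)
    by (simp add: assoc mult_inverse_cancel[OF cw cu _ uw(2)])
  \<comment> \<open>The condition that \<open>p / q\<close> has the value \<open>f\<close>, cleared
    of denominators so that density applies.\<close>
  let ?r = "lift p * mp_const (to_fract q) - mp_const (to_fract p) * lift q"
  have r_eval: "mp_eval (\<lambda>c. c) t ?r = mp_eval rf_const t p * to_fract q - to_fract p * mp_eval rf_const t q" for t
  proof -
    interpret t: comm_ring_hom "mp_eval (\<lambda>c::'k ratfun. c) t" by (rule comm_ring_hom_mp_eval[OF comm_ring_hom_id])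
    show ?thesis by (simp add: t.hom_minus t.hom_mult lift_eval mp_eval_const[OF comm_ring_hom_id])
  qed
  have r_vars: "mp_vars ?r \<subseteq> ?V"
  proof -
    have "mp_vars (mp_const (to_fract p) * lift q) \<subseteq> ?V" "mp_vars (lift p * mp_const (to_fract q)) \<subseteq> ?V"
      by (intro order_trans[OF mp_vars_mult] Un_least; use lift_vars pq(2,3) in simp)+
    moreover from this(1) have "mp_vars (- (mp_const (to_fract p) * lift q)) \<subseteq> ?V"
      by (simp add: mp_vars_def)
    ultimately show ?thesis
      unfolding diff_conv_add_uminus by (intro order_trans[OF mp_vars_add] Un_least)
  qed
  \<comment> \<open>Invariance gives the vanishing at all \<open>K\<close>-rational conjugates of
    the generic matrix; density extends it to the conjugate by \<open>u * G\<close>.\<close>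
  have "mp_eval (\<lambda>c. c) (pt M) ?r = 0"
    unfolding conj[symmetric]
  proof (rule uni_R_density[OF generic_rf_mat_carrier r_vars _ uG])
    fix k :: "'k mat" assume k: "uni R n k"
    then have kU: "k \<in> unipotent_radical n l I" by (simp add: unipotent_radical_eq)
    let ?e = "mp_eval rf_const (conj_point n k)"
    have "conj_act n k f = f" using f kU by (simp add: invariant_field_def)
    then have "?e p / ?e q = to_fract p / to_fract q" "?e q \<noteq> 0"
      using conj_act_Fract[OF unipotent_radical_invertible[OF I kU] pq(3,4)]
      by (simp_all add: pq(1) Fract_conv_to_fract)
    then show "mp_eval (\<lambda>c. c) (pt (adj_mat (map_mat rf_const k) * ?X * map_mat rf_const k)) ?r = 0"
      using q0 by (simp add: r_eval frac_eq_eq flip: conj_point_uni[OF k])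
  qed
  then have "to_fract p * mp_eval rf_const (pt M) q = mp_eval rf_const (pt M) p * to_fract q"
    unfolding r_eval by simp
  then have "f = mp_eval rf_const (pt M) p / mp_eval rf_const (pt M) q"
    using nz q0 by (simp add: pq(1) Fract_conv_to_fract M_def G_def frac_eq_eq)
  also have "\<dots> \<in> L"
  proof -
    \<comment> \<open>Conjugation by \<open>G\<close> stays inside \<open>L\<close> because the
      entries of \<open>g\<close> are constants.\<close>
    have G_L: "G $$ (i, j) \<in> L" if "i < n" "j < n" for i j
      using that const uniD(1)[OF g] by (auto simp: G_def)
    have M_L: "M $$ (i, j) \<in> L" if "i < n" "j < n" for i j
      unfolding M_def
      by (rule subfield_mult_mat[OF L _ subfield_mult_mat[OF L adjG(1) subfield_adj_mat[OF L cG G_L] cZ ZL] cG G_L that])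
        (use adjG(1) cZ in auto)
    have "pt M v \<in> L" if "v \<in> ?V" for v
      using that by (auto simp: pt_def entry_def intro!: M_L)
    then show ?thesis
      by (intro subfield_divide[OF L] subfield_mp_eval[OF L]) (use const pq in auto)
  qed
  finally show ?thesis .
qed

text \<open>Some point \<open>c\<close> with nonzero coordinates is not a zero of \<open>p\<close>,
  and the generators attain the values \<open>c\<close> at a matrix over \<open>K\<close>.
  Evaluating there a relation between the generators would give \<open>p\<close> the value 0 at
  \<open>c\<close>.\<close>

lemma J_alg_independent:
  "alg_independent (index_set n l I) (\<lambda>s. to_fract (J n s) :: 'k::field_char_0 ratfun)"
  unfolding alg_independent_def
proof (intro allI impI, rule ccontr)
  fix p :: "(nat \<times> nat, 'k) mpoly"
  assume p: "mp_vars p \<subseteq> index_set n l I" "mp_eval rf_const (\<lambda>s. to_fract (J n s)) p = 0" "p \<noteq> 0"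
  have "infinite (UNIV - {0 :: 'k})" using infinite_UNIV_char_0 by simp
  then obtain c where c: "range c \<subseteq> UNIV - {0 :: 'k}" "mp_eval (\<lambda>c. c) c p \<noteq> 0"
    using mp_eval_nonzero_point p(3) by blast
  obtain M :: "'k mat" where M: "M \<in> carrier_mat n n"
    "\<And>i j. i < n \<Longrightarrow> 1 \<le> j \<Longrightarrow> j \<le> n \<Longrightarrow> JM n M i j = c (Suc i, j)"
    by (rule exists_JM[of n "\<lambda>i j. c (Suc i, j)"]) (use c(1) in auto)
  let ?e = "mp_eval (\<lambda>c. c) (pt M)"
  interpret e: comm_ring_hom ?e by (rule comm_ring_hom_mp_eval[OF comm_ring_hom_id])
  have eJ: "?e (J n s) = c s" if "s \<in> index_set n l I" for s
    using that
  proof (rule index_setE)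
    fix i j assume s: "s = (Suc i, j)" and ij: "i < n" "1 \<le> j" "j \<le> n"
    then show "?e (J n s) = c s"
      using mp_eval_J[OF comm_ring_hom_id ij, of "pt M"] M(2)[OF ij] mat_pt[OF M(1)] by simp
  qed
  define Q where "Q = mp_eval mp_const (J n) p"
  have "to_fract Q = mp_eval rf_const (\<lambda>s. to_fract (J n s)) p"
    unfolding Q_def by (simp add: mp_eval_comp[OF comm_ring_hom_to_fract] rf_const_def[abs_def])
  then have "Q = 0" using p(2) by simp
  moreover have "?e Q = mp_eval (\<lambda>c. c) (\<lambda>s. ?e (J n s)) p"
    unfolding Q_def by (subst mp_eval_comp[OF e.comm_ring_hom_axioms]) (simp add: mp_eval_const[OF comm_ring_hom_id])
  moreover have "\<dots> = mp_eval (\<lambda>c. c) c p"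
    by (rule mp_eval_cong) (use eJ p(1) in auto)
  ultimately show False using c(2) by simp
qed

end

theorem theorem2p9:
  fixes n l :: nat and I :: "nat \<Rightarrow> nat set"
  assumes "n \<ge> 1"
    and "segment_partition n l I"
  shows "(\<forall>s \<in> index_set n l I.
            to_fract (J n s) \<in> (invariant_field n l I :: 'k::field_char_0 ratfun set)) \<and>
         alg_independent (index_set n l I) (\<lambda>s. to_fract (J n s) :: 'k ratfun) \<and>
         field_adjoin ((\<lambda>s. to_fract (J n s)) ` index_set n l I) =
           (invariant_field n l I :: 'k ratfun set)"
proof -
  obtain \<beta> where "segment_blocks n \<beta> l I" using ex_segment_blocks[OF assms(2)] by blast
  then interpret segment_blocks n \<beta> l I .
  have "field_adjoin ((\<lambda>s. to_fract (J n s)) ` index_set n l I) = (invariant_field n l I :: 'k ratfun set)"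
    unfolding field_adjoin_def
  proof (rule hull_unique)
    show "range rf_const \<union> (\<lambda>s. to_fract (J n s)) ` index_set n l I \<subseteq> (invariant_field n l I :: 'k ratfun set)"
      using J_invariant rf_const_invariant by auto
    show "is_subfield (invariant_field n l I :: 'k ratfun set)" by (rule invariant_subfield)
    fix L :: "'k ratfun set"
    assume A: "range rf_const \<union> (\<lambda>s. to_fract (J n s)) ` index_set n l I \<subseteq> L" and L: "is_subfield L"
    from A have const: "range rf_const \<subseteq> L" and gens: "(\<lambda>s. to_fract (J n s)) ` index_set n l I \<subseteq> L"
      by simp_all
    show "invariant_field n l I \<subseteq> L"
      by (intro subsetI invariant_field_minimal[OF L const subsetD[OF gens]] imageI)
  qed
  then show ?thesis by (intro conjI ballI J_invariant J_alg_independent)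
qed

end
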